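(* Let $X\subset\mathbb{P}^4$ be a smooth complex cubic threefold, let $\mathrm{F}(X)$ be its Fano surface of lines, and let $\mathrm{M}(X)\subset \mathrm{F}(X)$ be the curve of lines of the second type, with the scheme structure described in the context. Then the triple lines on $X$ are exactly the singular points of $\mathrm{M}(X)$; that is, for a line $\ell\subset X$, the line $\ell$ is a triple line on $X$ if and only if $[\ell]$ is a point of $\mathrm{M}(X)$ at which the curve $\mathrm{M}(X)$ is singular.
   Context: Let $X=\{F=0\}\subset\mathbb{P}^4$ be a smooth cubic hypersurface over $\mathbb{C}$, with homogeneous coordinates $(x_0:\dots:x_4)$. The Fano surface $\mathrm{F}(X)\subset\mathbb{G}(1,4)$ parametrizes the lines contained in $X$; it is a smooth surface. The point corresponding to a line $\ell\subset X$ is denoted $[\ell]$. Lines of the second type: a line $\ell\subset X$ is of the second type if there exists a unique 2-plane $P\simeq\mathbb{P}^2$ containing $\ell$ such that $P\cap X=2\ell\cup\ell'$ as plane cubic curves (divisors in $P$), for some line $\ell'\subset P$, where $\ell'=\ell$ is allowed. Equivalently, $P$ is tangent to $X$ at every point of $\ell$; equivalently, $\mathcal{N}_{\ell/X}\simeq\mathcal{O}_\ell(1)\oplus\mathcal{O}_\ell(-1)$. Triple lines: a line $\ell\subset X$ of the second type is called a triple line if the plane $P$ satisfies $P\cap X=3\ell$ (that is, $\ell'=\ell$). The curve $\mathrm{M}(X)$: the locus of $[\ell]\in\mathrm{F}(X)$ with $\ell$ of the second type is a curve (known). It is given locally by the following equations. Let $p_{i,j}$, $0\le i<j\le4$, be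 the Plücker coordinates on $\mathbb{G}(1,4)$. On the affine chart $p_{0,1}=1$, isomorphic to $\mathbb{C}^6$ with coordinates $(p_{0,2},p_{0,3},p_{0,4},p_{1,2},p_{1,3},p_{1,4})$, a line $\ell$ is spanned by $v_0=(1:0:-p_{1,2}:-p_{1,3}:-p_{1,4})$ and $v_1=(0:1:p_{0,2}:p_{0,3}:p_{0,4})$. Define functions $\phi^{i,j}$ and $\phi_i^{j,k}$ of these coordinates by $$F(t_0v_0+t_1v_1)=\sum_{i+j=3}t_0^it_1^j\phi^{i,j}(\ell),\qquad \frac{\partial F}{\partial x_i}(t_0v_0+t_1v_1)=\sum_{j+k=2}t_0^jt_1^k\phi_i^{j,k}(\ell)\quad(i=2,3,4),$$ and set $$\mathrm{m}(\ell)=\det\begin{pmatrix}\phi_2^{2,0}(\ell)&\phi_3^{2,0}(\ell)&\phi_4^{2,0}(\ell)\\ \phi_2^{1,1}(\ell)&\phi_3^{1,1}(\ell)&\phi_4^{1,1}(\ell)\\ \phi_2^{0,2}(\ell)&\phi_3^{0,2}(\ell)&\phi_4^{0,2}(\ell)\end{pmatrix}.$$ In this chart $\mathrm{F}(X)$ is defined by $\phi^{3,0}=\phi^{2,1}=\phi^{1,2}=\phi^{0,3}=0$, and $\mathrm{M}(X)$ is the subscheme defined by $$\phi^{3,0}=\phi^{2,1}=\phi^{1,2}=\phi^{0,3}=\mathrm{m}=0.$$ The other charts $p_{a,b}=1$ are treated in the same way after permuting the coordinates of $\mathbb{P}^4$. Singular points: a point $[\ell]\in\mathrm{M}(X)$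 is a singular point of $\mathrm{M}(X)$ if the Zariski tangent space of this scheme at $[\ell]$ has dimension strictly greater than $1$; equivalently, the $5\times6$ Jacobian matrix of the five equations above has rank less than $5$ at $[\ell]$. *)

theory Defs
  imports "HOL-Analysis.Analysis"
begin

text \<open>
  Projective 4-space is the projectivisation of \<^typ>\<open>complex^5\<close>, with coordinates
  \<open>x $ 0, \<dots>, x $ 4\<close>; its lines and planes are the linear subspaces of dimension 2 and 3.
  Since the ground field is infinite, a form is identified with the function it induces.
\<close>

definition homogeneous_form :: "nat \<Rightarrow> (complex^'n \<Rightarrow> complex) \<Rightarrow> bool" where
  "homogeneous_form d F \<longleftrightarrow>
     (\<exists>c :: ('n \<Rightarrow> nat) \<Rightarrow> complex. \<forall>x.
        F x = (\<Sum>\<alpha> | (\<Sum>i\<in>UNIV. \<alpha> i) = d. c \<alpha> * (\<Prod>i\<in>UNIV. x $ i ^ \<alpha> i)))"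

text \<open>The partial derivative; on polynomial functions it is the algebraic one.\<close>

definition partial :: "(complex^'n \<Rightarrow> complex) \<Rightarrow> 'n \<Rightarrow> complex^'n \<Rightarrow> complex" where
  "partial g i x = deriv (\<lambda>t. g (x + t *s axis i 1)) 0"

definition smooth_hypersurface :: "(complex^5 \<Rightarrow> complex) \<Rightarrow> bool" where
  "smooth_hypersurface F \<longleftrightarrow> (\<forall>x. x \<noteq> 0 \<and> F x = 0 \<longrightarrow> (\<exists>i. partial F i x \<noteq> 0))"

definition projective_line :: "(complex^5) set \<Rightarrow> bool" where
  "projective_line L \<longleftrightarrow> vec.subspace L \<and> vec.dim L = 2"

definition projective_plane :: "(complex^5) set \<Rightarrow> bool" where
  "projective_plane P \<longleftrightarrow> vec.subspace P \<and> vec.dim P = 3"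

definition line_on :: "(complex^5 \<Rightarrow> complex) \<Rightarrow> (complex^5) set \<Rightarrow> bool" where
  "line_on F L \<longleftrightarrow> projective_line L \<and> (\<forall>x\<in>L. F x = 0)"

text \<open>
  The plane section \<open>P \<inter> X\<close> equals \<open>2L + L'\<close> as a divisor in \<open>P\<close>: the restriction of \<open>F\<close> to \<open>P\<close>
  is \<open>a\<^sup>2 b\<close> up to a nonzero constant (absorbed in \<open>b\<close>), where \<open>a\<close> and \<open>b\<close> are
  equations of \<open>L\<close> and \<open>L'\<close> in \<open>P\<close>.
\<close>

definition plane_section_2L_L' ::
    "(complex^5 \<Rightarrow> complex) \<Rightarrow> (complex^5) set \<Rightarrow> (complex^5) set \<Rightarrow> (complex^5) set \<Rightarrow> bool" where
  "plane_section_2L_L' F P L L' \<longleftrightarrow>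
     projective_plane P \<and> projective_line L \<and> projective_line L' \<and>
     (\<exists>a b. homogeneous_form 1 a \<and> homogeneous_form 1 b \<and>
        L = {x\<in>P. a x = 0} \<and> L' = {x\<in>P. b x = 0} \<and>
        (\<forall>x\<in>P. F x = (a x)\<^sup>2 * b x))"

definition second_type :: "(complex^5 \<Rightarrow> complex) \<Rightarrow> (complex^5) set \<Rightarrow> bool" where
  "second_type F L \<longleftrightarrow> line_on F L \<and> (\<exists>!P. \<exists>L'. plane_section_2L_L' F P L L')"

definition triple_line :: "(complex^5 \<Rightarrow> complex) \<Rightarrow> (complex^5) set \<Rightarrow> bool" where
  "triple_line F L \<longleftrightarrow> second_type F L \<and> (\<exists>P. plane_section_2L_L' F P L L)"

text \<open>
  The chart \<open>p\<^sub>0\<^sub>1 = 1\<close> of the Grassmannian; the entries of \<^typ>\<open>complex^6\<close> are, in order,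
  \<open>p\<^sub>0\<^sub>2, p\<^sub>0\<^sub>3, p\<^sub>0\<^sub>4, p\<^sub>1\<^sub>2, p\<^sub>1\<^sub>3, p\<^sub>1\<^sub>4\<close>.
\<close>

definition v0 :: "complex^6 \<Rightarrow> complex^5" where
  "v0 p = axis 0 1 - p $ 3 *s axis 2 1 - p $ 4 *s axis 3 1 - p $ 5 *s axis 4 1"

definition v1 :: "complex^6 \<Rightarrow> complex^5" where
  "v1 p = axis 1 1 + p $ 0 *s axis 2 1 + p $ 1 *s axis 3 1 + p $ 2 *s axis 4 1"

definition chart_line :: "complex^6 \<Rightarrow> (complex^5) set" where
  "chart_line p = vec.span {v0 p, v1 p}"

text \<open>
  For a form \<open>G\<close> of degree \<open>i + j\<close>, the coefficient of \<open>t\<^sub>0\<^sup>i t\<^sub>1\<^sup>j\<close> in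
  \<open>G (t\<^sub>0 v\<^sub>0 + t\<^sub>1 v\<^sub>1)\<close>.  So \<open>phi F i j\<close> is \<open>\<phi>\<^sup>i\<^sup>,\<^sup>j\<close> and \<open>phi (partial F k) i j\<close> is
  \<open>\<phi>\<^sub>k\<^sup>i\<^sup>,\<^sup>j\<close>.
\<close>

definition phi :: "(complex^5 \<Rightarrow> complex) \<Rightarrow> nat \<Rightarrow> nat \<Rightarrow> complex^6 \<Rightarrow> complex" where
  "phi G i j p = (THE c. \<exists>a. a i = c \<and>
     (\<forall>t0 t1. G (t0 *s v0 p + t1 *s v1 p) = (\<Sum>k\<le>i+j. t0 ^ k * t1 ^ (i + j - k) * a k)))"

definition m :: "(complex^5 \<Rightarrow> complex) \<Rightarrow> complex^6 \<Rightarrow> complex" where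
  "m F p = det (vector
     [vector [phi (partial F 2) 2 0 p, phi (partial F 3) 2 0 p, phi (partial F 4) 2 0 p],
      vector [phi (partial F 2) 1 1 p, phi (partial F 3) 1 1 p, phi (partial F 4) 1 1 p],
      vector [phi (partial F 2) 0 2 p, phi (partial F 3) 0 2 p, phi (partial F 4) 0 2 p]]
     :: complex^3^3)"

definition M_equations :: "(complex^5 \<Rightarrow> complex) \<Rightarrow> (complex^6 \<Rightarrow> complex) set" where
  "M_equations F = {phi F 3 0, phi F 2 1, phi F 1 2, phi F 0 3, m F}"

definition zariski_tangent_space ::
    "(complex^'n \<Rightarrow> complex) set \<Rightarrow> complex^'n \<Rightarrow> (complex^'n) set" where
  "zariski_tangent_space E p = {w. \<forall>g\<in>E. (\<Sum>k\<in>UNIV. partial g k p * w $ k) = 0}"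

text \<open>
  The remaining charts are obtained from a permutation \<open>\<sigma>\<close> of the coordinates: in the
  coordinates \<open>y\<close> with \<open>x = permute_coords \<sigma> y\<close>, the equation of \<open>X\<close> is
  \<open>F \<circ> permute_coords \<sigma>\<close>.
\<close>

definition permute_coords :: "(5 \<Rightarrow> 5) \<Rightarrow> complex^5 \<Rightarrow> complex^5" where
  "permute_coords \<sigma> y = (\<chi> i. y $ \<sigma> i)"

definition M_point_in_chart ::
    "(complex^5 \<Rightarrow> complex) \<Rightarrow> (complex^5) set \<Rightarrow> (5 \<Rightarrow> 5) \<Rightarrow> complex^6 \<Rightarrow> bool" where
  "M_point_in_chart F L \<sigma> p \<longleftrightarrow>
     bij \<sigma> \<and> L = permute_coords \<sigma> ` chart_line p \<and>
     (\<forall>g \<in> M_equations (F \<circ> permute_coords \<sigma>). g p = 0)"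

definition M_singular_point :: "(complex^5 \<Rightarrow> complex) \<Rightarrow> (complex^5) set \<Rightarrow> bool" where
  "M_singular_point F L \<longleftrightarrow>
     (\<exists>\<sigma> p. M_point_in_chart F L \<sigma> p \<and>
        vec.dim (zariski_tangent_space (M_equations (F \<circ> permute_coords \<sigma>)) p) > 1)"

end

theory Submission
  imports Defs "HOL-Computational_Algebra.Fundamental_Theorem_Algebra"
begin

text \<open>
  Polarise the cubic as \<open>F x = T x x x\<close> with \<open>T\<close> symmetric and trilinear, let \<open>L\<close> be a line
  on the threefold spanned by \<open>a\<close> and \<open>b\<close>, and choose a three-dimensional complement of \<open>L\<close>.
  For \<open>u\<close> in the complement, \<open>q\<^sub>u(x) = T x x u\<close> is a binary quadratic form on \<open>L\<close>, linear in
  \<open>u\<close>; it is a third of the derivative of \<open>F\<close> along \<open>L\<close> in the direction \<open>u\<close>.  Smoothness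
  along \<open>L\<close> says that the forms \<open>q\<^sub>u\<close> have no common zero on \<open>L\<close>.

  For \<open>x\<close> on \<open>L\<close> one has \<open>F (x + r u) = 3 r T x x u + 3 r\<^sup>2 T x u u + r\<^sup>3 T u u u\<close>.  So the
  plane through \<open>L\<close> and \<open>u\<close> is tangent along \<open>L\<close> if and only if \<open>q\<^sub>u = 0\<close>, and it then cuts
  out \<open>3 L\<close> if and only if also the linear form \<open>\<rho>(x) = T x u u\<close> vanishes on \<open>L\<close>.  The
  remaining coefficient \<open>T u u u\<close> is then nonzero, since a smooth cubic threefold contains no
  plane: on a plane inside it the derivatives in two transversal directions are conics, and two
  conics meet.

  Suppose that \<open>q\<^sub>u = 0\<close> with \<open>u \<noteq> 0\<close>.  The space \<open>V\<close> of all \<open>q\<^sub>w\<close> has dimension at most two,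
  and it has dimension exactly two because a single binary quadratic form has a zero.  Hence
  \<open>u\<close> is unique up to a scalar, and so is the tangent plane.  Moreover, for a linear form
  \<open>l \<noteq> 0\<close> the space \<open>V\<close> cannot contain both \<open>s l\<close> and \<open>t l\<close>, where \<open>s, t\<close> are the coordinates
  on \<open>L\<close>: these two would span \<open>V\<close>, and the zero of \<open>l\<close> would be a common zero.  This is
  \<open>no_common_factor\<close>, and it decides both implications below.

  A tangent vector of the Grassmannian at \<open>L\<close> is a pair \<open>(x, y)\<close> of vectors of the complement,
  moving \<open>a\<close> in the direction \<open>x\<close> and \<open>b\<close> in the direction \<open>y\<close>.  It is tangent to the Fano
  surface if and only if \<open>s q\<^sub>x + t q\<^sub>y = 0\<close>.  Then \<open>q\<^sub>x = t l\<close> and \<open>q\<^sub>y = - s l\<close> for a linear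
  form \<open>l\<close>, so \<open>l = 0\<close>, and \<open>x, y\<close> are multiples of \<open>u\<close>.  The fifth equation \<open>m\<close> is, up to a
  constant, the determinant of \<open>q\<^sub>u, q\<^sub>y, q\<^sub>z\<close> for any basis \<open>u, y, z\<close> of the complement; so the
  curve consists of the lines for which some \<open>q\<^sub>u\<close> with \<open>u \<noteq> 0\<close> is zero.
  Where \<open>q\<^sub>u = 0\<close>, its differential only sees the derivative of \<open>q\<^sub>u\<close>, which in the direction
  \<open>(\<alpha> u, \<beta> u)\<close> is \<open>2 (\<alpha> s + \<beta> t) \<rho>\<close>.  Thus the tangent space of the curve has dimension two
  if and only if all \<open>(\<alpha> s + \<beta> t) \<rho>\<close> lie in \<open>V\<close>, that is, if and only if \<open>\<rho> = 0\<close>.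
\<close>

section \<open>Linear algebra in three coordinates\<close>

definition det3 :: "complex^3 \<Rightarrow> complex^3 \<Rightarrow> complex^3 \<Rightarrow> complex" where
  "det3 x y z = det (vector [x, y, z] :: complex^3^3)"

lemma det3_expand:
  "det3 x y z = x$1 * (y$2 * z$3 - y$3 * z$2) + x$2 * (y$3 * z$1 - y$1 * z$3)
     + x$3 * (y$1 * z$2 - y$2 * z$1)"
  unfolding det3_def det_3 by (simp add: algebra_simps)

lemma det3_add1: "det3 (x + x') y z = det3 x y z + det3 x' y z"
  and det3_add2: "det3 x (y + y') z = det3 x y z + det3 x y' z"
  and det3_add3: "det3 x y (z + z') = det3 x y z + det3 x y z'"
  and det3_scale1: "det3 (c *s x) y z = c * det3 x y z"
  and det3_scale2: "det3 x (c *s y) z = c * det3 x y z"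
  and det3_scale3: "det3 x y (c *s z) = c * det3 x y z"
  unfolding det3_expand by (simp_all add: algebra_simps)

lemmas det3_multilinear = det3_add1 det3_add2 det3_add3 det3_scale1 det3_scale2 det3_scale3

lemma det3_repeat: "det3 x x z = 0" "det3 x y x = 0" "det3 x y y = 0"
  unfolding det3_expand by (simp_all add: algebra_simps)

lemma det3_dependent:
  assumes "det3 x y z = 0"
  obtains k :: "complex^3" where "k \<noteq> 0" "k$1 *s x + k$2 *s y + k$3 *s z = 0"
proof -
  let ?A = "vector [x, y, z] :: complex^3^3"
  have "\<not> invertible (transpose ?A)"
    using assms by (simp add: invertible_det_nz det3_def)
  then obtain k where "k \<noteq> 0" "transpose ?A *v k = 0"
    unfolding invertible_left_inverse matrix_left_invertible_ker by auto
  then show thesis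
    by (intro that[of k])
      (simp_all add: vec_eq_iff matrix_vector_mult_def transpose_def sum_3 mult.commute)
qed

lemma det3_basis:
  assumes "det3 x y z \<noteq> 0"
  obtains a b c where "w = a *s x + b *s y + c *s z"
proof -
  let ?d = "det3 x y z"
  have "w = (det3 w y z / ?d) *s x + (det3 x w z / ?d) *s y + (det3 x y w / ?d) *s z"
  proof -
    have "?d * w$i = det3 w y z * x$i + det3 x w z * y$i + det3 x y w * z$i" for i
      using exhaust_3[of i] unfolding det3_expand by (auto simp: algebra_simps)
    then show ?thesis using assms by (simp add: vec_eq_iff field_simps)
  qed
  then show thesis by (rule that)
qed

lemma det3_independent:
  assumes "det3 x y z \<noteq> 0" "a *s x + b *s y + c *s z = 0"
  shows "a = 0 \<and> b = 0 \<and> c = 0"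
proof -
  define w where "w = a *s x + b *s y + c *s z"
  have "det3 w y z = a * det3 x y z" "det3 x w z = b * det3 x y z" "det3 x y w = c * det3 x y z"
    by (simp_all add: w_def det3_multilinear det3_repeat)
  moreover have "det3 w y z = 0" "det3 x w z = 0" "det3 x y w = 0"
    using assms(2) by (simp_all add: w_def det3_expand)
  ultimately show ?thesis using assms(1) by simp
qed

lemma extend_to_det3_nonzero:
  fixes u :: "complex^3"
  assumes "u \<noteq> 0"
  obtains y z where "det3 u y z \<noteq> 0"
proof -
  have "u$1 \<noteq> 0 \<or> u$2 \<noteq> 0 \<or> u$3 \<noteq> 0" using assms by (auto simp: vec_eq_iff forall_3)
  then show thesis
    using that[of "axis 2 1" "axis 3 1"] that[of "axis 1 1" "axis 3 1"] that[of "axis 1 1" "axis 2 1"]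
    by (auto simp: det3_expand axis_def)
qed

lemma complex3_axes: "(u::complex^3) = u$1 *s axis 1 1 + u$2 *s axis 2 1 + u$3 *s axis 3 1"
  by (simp add: vec_eq_iff forall_3 axis_def)

text \<open>Multiplicativity of the determinant in a form that does not mention matrices; it relates the
  values of \<open>f\<close> on any two triples.\<close>

lemma det3_linear_image:
  fixes f :: "complex^3 \<Rightarrow> complex^3"
  assumes add: "\<And>x y. f (x + y) = f x + f y" and scale: "\<And>c x. f (c *s x) = c *s f x"
  shows "det3 (f x) (f y) (f z)
    = det3 x y z * det3 (f (axis 1 1)) (f (axis 2 1)) (f (axis 3 1))"
proof -
  have e: "f u $ i = u$1 * f (axis 1 1) $ i + u$2 * f (axis 2 1) $ i + u$3 * f (axis 3 1) $ i" for u i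
    by (subst complex3_axes[of u]) (simp add: add scale)
  have "(vector [f x, f y, f z] :: complex^3^3)
      = vector [x, y, z] ** vector [f (axis 1 1), f (axis 2 1), f (axis 3 1)]"
    by (simp add: vec_eq_iff matrix_matrix_mult_def sum_3 forall_3 e[of x] e[of y] e[of z])
  then show ?thesis by (simp add: det3_def det_mul)
qed

section \<open>Two conics in the projective plane meet\<close>

lemma binary_quadratic_root:
  fixes a b c :: complex
  obtains s t where "(s, t) \<noteq> (0, 0)" "a * s\<^sup>2 + b * s * t + c * t\<^sup>2 = 0"
proof (cases "a = 0")
  case True
  then show thesis using that[of 1 0] by simp
next
  case False
  define s where "s = (- b + csqrt (b\<^sup>2 - 4 * a * c)) / (2 * a)"
  have "(2 * a * s + b)\<^sup>2 = b\<^sup>2 - 4 * a * c"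
    using False by (simp add: s_def)
  then have "4 * a * (a * s\<^sup>2 + b * s + c) = 0" by algebra
  then have "a * s\<^sup>2 + b * s + c = 0" using False by simp
  then show thesis using that[of s 1] by simp
qed

text \<open>A plane conic is encoded by its polar form, so that degeneracy and restriction to a line are
  linear algebra.\<close>

locale conic =
  fixes B :: "complex^3 \<Rightarrow> complex^3 \<Rightarrow> complex"
  assumes add: "B (x + x') y = B x y + B x' y"
    and scale: "B (c *s x) y = c * B x y"
    and sym: "B x y = B y x"
begin

lemma add_right: "B x (y + y') = B x y + B x y'"
  and scale_right: "B x (c *s y) = c * B x y"
  using add scale sym by metis+

lemma zero_on_line:
  obtains s t where "(s, t) \<noteq> (0, 0)" "B (s *s x + t *s y) (s *s x + t *s y) = 0"
proof -
  obtain s t where "(s, t) \<noteq> (0, 0)" "B x x * s\<^sup>2 + (2 * B x y) * s * t + B y y * t\<^sup>2 = 0"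
    by (rule binary_quadratic_root)
  then show thesis
    by (intro that[of s t])
      (auto simp: add add_right scale scale_right sym[of y x] power2_eq_square algebra_simps)
qed

end

text \<open>A degenerate conic with vertex \<open>v\<close> is a cone: any of its points off the vertex gives a whole
  line in it, and the other conic has a zero on that line.\<close>

lemma degenerate_conic_meets_conic:
  assumes "conic A" "conic B" and v: "v \<noteq> 0" "\<And>w. A v w = 0"
  obtains x where "x \<noteq> 0" "A x x = 0" "B x x = 0"
proof -
  interpret A: conic A by fact
  interpret B: conic B by fact
  obtain y z where d: "det3 v y z \<noteq> 0" using extend_to_det3_nonzero v(1) by blast
  obtain s t where st: "(s, t) \<noteq> (0, 0)" "A (s *s y + t *s z) (s *s y + t *s z) = 0"
    by (rule A.zero_on_line)
  define w where "w = s *s y + t *s z"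
  obtain p q where pq: "(p, q) \<noteq> (0, 0)" "B (p *s v + q *s w) (p *s v + q *s w) = 0"
    by (rule B.zero_on_line)
  have "p *s v + q *s w \<noteq> 0"
  proof
    assume "p *s v + q *s w = 0"
    then have "p *s v + (q * s) *s y + (q * t) *s z = 0"
      by (simp add: w_def vec_eq_iff algebra_simps)
    then show False using det3_independent[OF d, of p "q * s" "q * t"] st(1) pq(1) by auto
  qed
  moreover have "A (p *s v + q *s w) (p *s v + q *s w) = 0"
    using v(2) st(2) A.sym[of w v] unfolding w_def[symmetric]
    by (simp add: A.add A.add_right A.scale A.scale_right)
  ultimately show thesis using that pq(2) by blast
qed

text \<open>The pencil spanned by \<open>A\<close> and \<open>B\<close> has a degenerate member, because its determinant is a
  cubic polynomial in the parameter whose leading coefficient is the determinant of \<open>B\<close>.\<close>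

lemma two_conics_meet:
  assumes "conic A" "conic B"
  obtains x where "x \<noteq> 0" "A x x = 0" "B x x = 0"
proof -
  interpret A: conic A by fact
  interpret B: conic B by fact
  define r where "r C = (\<lambda>i. vector [C (axis i 1) (axis 1 1), C (axis i 1) (axis 2 1),
      C (axis i 1) (axis 3 1)] :: complex^3)" for C :: "complex^3 \<Rightarrow> complex^3 \<Rightarrow> complex"
  have ker: "\<exists>v. v \<noteq> 0 \<and> (\<forall>w. C v w = 0)"
    if C: "conic C" and det: "det3 (r C 1) (r C 2) (r C 3) = 0" for C
  proof -
    interpret C: conic C by fact
    obtain k :: "complex^3" where k: "k \<noteq> 0" "k$1 *s r C 1 + k$2 *s r C 2 + k$3 *s r C 3 = 0"
      using det by (rule det3_dependent)
    have row: "C k w = k$1 * C (axis 1 1) w + k$2 * C (axis 2 1) w + k$3 * C (axis 3 1) w" for w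
      by (subst complex3_axes[of k]) (simp only: C.add C.scale)
    have "C k (axis 1 1) = 0" "C k (axis 2 1) = 0" "C k (axis 3 1) = 0"
      unfolding row using k(2) by (auto simp: r_def vec_eq_iff forall_3)
    then have "\<forall>w. C k w = 0"
      by (metis complex3_axes C.add_right C.scale_right add_0 mult_zero_right)
    then show ?thesis using k(1) by blast
  qed
  show thesis
  proof (cases "det3 (r B 1) (r B 2) (r B 3) = 0")
    case True
    then obtain v where "v \<noteq> 0" "\<And>w. B v w = 0" using ker[OF assms(2)] by blast
    then show thesis using degenerate_conic_meets_conic[OF assms(2,1)] that by metis
  next
    case False
    define C where "C t = (\<lambda>x y. A x y + t * B x y)" for t
    have C: "conic (C t)" for t
    proof
      fix x x' y c
      show "C t (x + x') y = C t x y + C t x' y" "C t (c *s x) y = c * C t x y"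
        by (simp_all add: C_def A.add B.add A.scale B.scale algebra_simps)
      show "C t x y = C t y x" unfolding C_def by (metis A.sym B.sym)
    qed
    define a b where "a = r A" and "b = r B"
    define p where "p = [: det3 (a 1) (a 2) (a 3),
        det3 (b 1) (a 2) (a 3) + det3 (a 1) (b 2) (a 3) + det3 (a 1) (a 2) (b 3),
        det3 (a 1) (b 2) (b 3) + det3 (b 1) (a 2) (b 3) + det3 (b 1) (b 2) (a 3),
        det3 (b 1) (b 2) (b 3) :]"
    have "degree p \<noteq> 0" using False by (simp add: p_def b_def)
    then obtain t where "poly p t = 0"
      using fundamental_theorem_of_algebra[of p] constant_degree[of p] by metis
    moreover have "r (C t) i = a i + t *s b i" for i
      by (simp add: r_def C_def a_def b_def vec_eq_iff forall_3)
    then have "det3 (r (C t) 1) (r (C t) 2) (r (C t) 3) = poly p t"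
      by (simp add: p_def det3_multilinear algebra_simps)
    ultimately obtain v where "v \<noteq> 0" "\<And>w. C t v w = 0" using ker[OF C] by metis
    then obtain x where "x \<noteq> 0" "C t x x = 0" "B x x = 0"
      using degenerate_conic_meets_conic[OF C assms(2)] by metis
    then show thesis using that by (simp add: C_def)
  qed
qed

section \<open>Forms of degree one and three\<close>

text \<open>The exponents of total degree one are the indicator functions of single coordinates.\<close>

lemma homogeneous_form_1_iff:
  fixes f :: "complex^'n \<Rightarrow> complex"
  shows "homogeneous_form 1 f \<longleftrightarrow> (\<exists>c. \<forall>x. f x = (\<Sum>i\<in>UNIV. c i * x $ i))"
proof -
  define \<delta> where "\<delta> i = (\<lambda>j. if j = i then 1 else 0 :: nat)" for i :: 'n
  have bij: "bij_betw \<delta> UNIV {\<alpha>. (\<Sum>i\<in>UNIV. \<alpha> i) = 1}"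
  proof (rule bij_betwI')
    fix x y :: 'n
    show "\<delta> x = \<delta> y \<longleftrightarrow> x = y" by (metis \<delta>_def zero_neq_one)
    show "\<delta> x \<in> {\<alpha>. (\<Sum>i\<in>UNIV. \<alpha> i) = 1}" by (simp add: \<delta>_def)
  next
    fix \<alpha> :: "'n \<Rightarrow> nat" assume "\<alpha> \<in> {\<alpha>. (\<Sum>i\<in>UNIV. \<alpha> i) = 1}"
    then obtain i where i: "\<alpha> i = 1" "\<forall>j. j \<noteq> i \<longrightarrow> \<alpha> j = 0"
      using sum_eq_1_iff[of UNIV \<alpha>] by auto
    have "\<alpha> = \<delta> i" unfolding \<delta>_def fun_eq_iff using i by auto
    then show "\<exists>i\<in>UNIV. \<alpha> = \<delta> i" by auto
  qed
  have mono: "(\<Prod>j\<in>UNIV. x $ j ^ \<delta> i j) = x $ i" for x :: "complex^'n" and i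
  proof -
    have "(\<Prod>j\<in>UNIV. x $ j ^ \<delta> i j) = (\<Prod>j\<in>UNIV. if j = i then x $ j else 1)"
      by (rule prod.cong) (auto simp: \<delta>_def)
    then show ?thesis by simp
  qed
  have eq: "(\<Sum>\<alpha> | (\<Sum>i\<in>UNIV. \<alpha> i) = 1. c \<alpha> * (\<Prod>i\<in>UNIV. x $ i ^ \<alpha> i))
      = (\<Sum>i\<in>UNIV. c (\<delta> i) * x $ i)" for c and x :: "complex^'n"
    by (subst sum.reindex_bij_betw[OF bij, symmetric]) (simp add: mono)
  have "inj \<delta>" using bij by (simp add: bij_betw_def)
  then have "\<exists>c'. \<forall>i. c' (\<delta> i) = c i" for c :: "'n \<Rightarrow> complex"
    by (intro exI[of _ "\<lambda>\<alpha>. c (inv \<delta> \<alpha>)"]) (simp add: inv_f_f)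
  then show ?thesis
    unfolding homogeneous_form_def eq
  proof safe
    fix c assume "\<forall>x. f x = (\<Sum>i\<in>UNIV. c (\<delta> i) * x $ i)"
    then show "\<exists>c. \<forall>x. f x = (\<Sum>i\<in>UNIV. c i * x $ i)"
      by (intro exI[of _ "\<lambda>i. c (\<delta> i)"])
  next
    fix c assume f: "\<forall>x. f x = (\<Sum>i\<in>UNIV. c i * x $ i)"
    obtain c' where "\<forall>i. c' (\<delta> i) = c i" using \<open>\<And>c. \<exists>c'. \<forall>i. c' (\<delta> i) = c i\<close> by blast
    then show "\<exists>c. \<forall>x. f x = (\<Sum>i\<in>UNIV. c (\<delta> i) * x $ i)"
      using f by (intro exI[of _ c']) simp
  qed
qed

lemma linear_expansion:
  fixes f :: "complex^'n \<Rightarrow> complex"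
  assumes add: "\<And>x y. f (x + y) = f x + f y" and scale: "\<And>c x. f (c *s x) = c * f x"
  shows "(\<Sum>i\<in>UNIV. f (axis i 1) * x $ i) = f x"
proof -
  have f0: "f 0 = 0" using scale[of 0 0] by simp
  have "f x = f (\<Sum>i\<in>UNIV. x $ i *s axis i 1)" by (simp add: basis_expansion)
  also have "\<dots> = (\<Sum>i\<in>UNIV. f (x $ i *s axis i 1))"
    using sum_comp_morphism[of f "\<lambda>i. x $ i *s axis i 1" UNIV] f0 add by (simp add: o_def)
  finally show ?thesis by (simp add: scale mult.commute)
qed

lemma homogeneous_form_1I:
  fixes f :: "complex^'n \<Rightarrow> complex"
  assumes "\<And>x y. f (x + y) = f x + f y" and "\<And>c x. f (c *s x) = c * f x"
  shows "homogeneous_form 1 f"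
  unfolding homogeneous_form_1_iff
  by (intro exI[of _ "\<lambda>i. f (axis i 1)"] allI linear_expansion[symmetric] assms)

lemma homogeneous_form_1D:
  assumes "homogeneous_form 1 f"
  shows "f (x + y) = f x + f y" "f (c *s x) = c * f x"
proof -
  obtain d where "\<And>x. f x = (\<Sum>i\<in>UNIV. d i * x $ i)"
    using assms unfolding homogeneous_form_1_iff by blast
  then show "f (x + y) = f x + f y" "f (c *s x) = c * f x"
    by (simp_all add: algebra_simps sum.distrib sum_distrib_left)
qed

locale symmetric_trilinear =
  fixes T :: "complex^'n \<Rightarrow> complex^'n \<Rightarrow> complex^'n \<Rightarrow> complex"
  assumes add1: "T (x + x') y z = T x y z + T x' y z"
    and scale1: "T (c *s x) y z = c * T x y z"
    and swap12: "T x y z = T y x z"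
    and swap23: "T x y z = T x z y"
begin

lemma add2: "T x (y + y') z = T x y z + T x y' z"
  and add3: "T x y (z + z') = T x y z + T x y z'"
  and scale2: "T x (c *s y) z = c * T x y z"
  and scale3: "T x y (c *s z) = c * T x y z"
  using add1 scale1 swap12 swap23 by metis+

lemma zero1: "T 0 y z = 0" and zero2: "T x 0 z = 0" and zero3: "T x y 0 = 0"
  using scale1[of 0 0] scale2[of _ 0 0] scale3[of _ _ 0 0] by simp_all

lemmas multilinear = add1 add2 add3 scale1 scale2 scale3 zero1 zero2 zero3
lemmas swaps = swap12 swap23

lemma cube_of_sum:
  "T (x + r *s y) (x + r *s y) (x + r *s y)
    = T x x x + 3 * r * T x x y + 3 * r\<^sup>2 * T x y y + r ^ 3 * T y y y"
proof -
  have "T x y x = T x x y" "T y x x = T x x y" "T y x y = T x y y" "T y y x = T x y y"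
    using swap12 swap23 by metis+
  then show ?thesis
    by (simp add: multilinear power2_eq_square power3_eq_cube algebra_simps)
qed

lemma square_of_sum:
  "T (s *s x + t *s y) (s *s x + t *s y) z = s\<^sup>2 * T x x z + 2 * s * t * T x y z + t\<^sup>2 * T y y z"
  by (simp add: multilinear swap12[of y x] power2_eq_square algebra_simps)

lemma cube_of_comb:
  "T (s *s x + t *s y) (s *s x + t *s y) (s *s x + t *s y)
    = s ^ 3 * T x x x + 3 * s\<^sup>2 * t * T x x y + 3 * s * t\<^sup>2 * T x y y + t ^ 3 * T y y y"
  unfolding cube_of_sum by (simp add: multilinear power2_eq_square power3_eq_cube)

end

lemma monomial_split:
  fixes \<alpha> :: "'n::finite \<Rightarrow> nat"
  assumes "(\<Sum>i\<in>UNIV. \<alpha> i) = Suc d"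
  obtains a \<beta> where "(\<Sum>i\<in>UNIV. \<beta> i) = d"
    "\<And>x :: complex^'n. (\<Prod>i\<in>UNIV. x $ i ^ \<alpha> i) = x $ a * (\<Prod>i\<in>UNIV. x $ i ^ \<beta> i)"
proof -
  obtain a where a: "\<alpha> a \<noteq> 0" using assms by (metis nat.distinct(1) sum.neutral)
  define \<beta> where "\<beta> = \<alpha>(a := \<alpha> a - 1)"
  have rest: "(\<Sum>i\<in>UNIV - {a}. \<beta> i) = (\<Sum>i\<in>UNIV - {a}. \<alpha> i)"
    by (rule sum.cong) (auto simp: \<beta>_def)
  have "(\<Sum>i\<in>UNIV. \<beta> i) = d"
    using assms a rest sum.remove[of UNIV a \<alpha>] sum.remove[of UNIV a \<beta>] by (simp add: \<beta>_def)
  moreover have "(\<Prod>i\<in>UNIV. x $ i ^ \<alpha> i) = x $ a * (\<Prod>i\<in>UNIV. x $ i ^ \<beta> i)" for x :: "complex^'n"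
  proof -
    have "(\<Prod>i\<in>UNIV - {a}. x $ i ^ \<beta> i) = (\<Prod>i\<in>UNIV - {a}. x $ i ^ \<alpha> i)"
      by (rule prod.cong) (auto simp: \<beta>_def)
    then have "(\<Prod>i\<in>UNIV. x $ i ^ \<beta> i) = x $ a ^ (\<alpha> a - 1) * (\<Prod>i\<in>UNIV - {a}. x $ i ^ \<alpha> i)"
      using prod.remove[of UNIV a "\<lambda>i. x $ i ^ \<beta> i"] by (simp add: \<beta>_def)
    moreover have "x $ a ^ \<alpha> a = x $ a * x $ a ^ (\<alpha> a - 1)"
      using a by (metis Suc_diff_1 neq0_conv power_Suc)
    ultimately show ?thesis
      using prod.remove[of UNIV a "\<lambda>i. x $ i ^ \<alpha> i"] by simp
  qed
  ultimately show thesis by (rule that)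
qed

text \<open>Forms that come from a symmetric trilinear map are closed under sums, so it suffices to
  symmetrise a monomial, written as a product of three coordinates.\<close>

lemma cubic_form_polarization:
  fixes F :: "complex^'n \<Rightarrow> complex"
  assumes "homogeneous_form 3 F"
  obtains T where "symmetric_trilinear T" "\<And>x. F x = T x x x"
proof -
  define polar where "polar G \<longleftrightarrow> (\<exists>T. symmetric_trilinear T \<and> (\<forall>x. G x = T x x x))"
    for G :: "complex^'n \<Rightarrow> complex"
  have zero: "polar (\<lambda>x. 0)"
    unfolding polar_def by (rule exI[of _ "\<lambda>x y z. 0"]) (auto intro: symmetric_trilinear.intro)
  have add: "polar (\<lambda>x. G x + H x)" if "polar G" "polar H" for G H
  proof -
    obtain S T where S: "symmetric_trilinear S" "\<forall>x. G x = S x x x"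
      and T: "symmetric_trilinear T" "\<forall>x. H x = T x x x"
      using \<open>polar G\<close> \<open>polar H\<close> unfolding polar_def by blast
    interpret S: symmetric_trilinear S by fact
    interpret T: symmetric_trilinear T by fact
    have "symmetric_trilinear (\<lambda>x y z. S x y z + T x y z)"
      by unfold_locales (simp_all add: S.multilinear T.multilinear algebra_simps S.swaps T.swaps)
    then show ?thesis using S(2) T(2) unfolding polar_def
      by (intro exI[of _ "\<lambda>x y z. S x y z + T x y z"]) simp
  qed
  have monomial: "polar (\<lambda>x. c * (\<Prod>i\<in>UNIV. x $ i ^ \<alpha> i))" if \<alpha>: "(\<Sum>i\<in>UNIV. \<alpha> i) = 3" for c \<alpha>
  proof -
    obtain a \<beta> where \<beta>: "(\<Sum>i\<in>UNIV. \<beta> i) = 2"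
      "\<And>x :: complex^'n. (\<Prod>i\<in>UNIV. x $ i ^ \<alpha> i) = x $ a * (\<Prod>i\<in>UNIV. x $ i ^ \<beta> i)"
      by (rule monomial_split[of \<alpha> 2]) (use \<alpha> in simp, blast)
    obtain b \<gamma> where \<gamma>: "(\<Sum>i\<in>UNIV. \<gamma> i) = 1"
      "\<And>x :: complex^'n. (\<Prod>i\<in>UNIV. x $ i ^ \<beta> i) = x $ b * (\<Prod>i\<in>UNIV. x $ i ^ \<gamma> i)"
      by (rule monomial_split[of \<beta> 1]) (use \<beta>(1) in simp, blast)
    obtain d \<epsilon> where \<epsilon>: "(\<Sum>i\<in>UNIV. \<epsilon> i) = 0"
      "\<And>x :: complex^'n. (\<Prod>i\<in>UNIV. x $ i ^ \<gamma> i) = x $ d * (\<Prod>i\<in>UNIV. x $ i ^ \<epsilon> i)"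
      by (rule monomial_split[of \<gamma> 0]) (use \<gamma>(1) in simp, blast)
    define T where "T x y z = c / 6 *
      (x$a * y$b * z$d + x$a * z$b * y$d + y$a * x$b * z$d + y$a * z$b * x$d + z$a * x$b * y$d + z$a * y$b * x$d)"
      for x y z :: "complex^'n"
    have "symmetric_trilinear T"
      by unfold_locales (simp_all add: T_def algebra_simps)
    moreover have "c * (\<Prod>i\<in>UNIV. x $ i ^ \<alpha> i) = T x x x" for x :: "complex^'n"
      using \<epsilon>(1) unfolding \<beta>(2) \<gamma>(2) \<epsilon>(2) T_def by simp
    ultimately show ?thesis unfolding polar_def by blast
  qed
  have "polar (\<lambda>x. \<Sum>\<alpha>\<in>S. c \<alpha> * (\<Prod>i\<in>UNIV. x $ i ^ \<alpha> i))"
    if "S \<subseteq> {\<alpha>. (\<Sum>i\<in>UNIV. \<alpha> i) = 3}" for S c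
    using that by (induction S rule: infinite_finite_induct) (simp_all add: zero add monomial)
  moreover obtain c where "F = (\<lambda>x. \<Sum>\<alpha> | (\<Sum>i\<in>UNIV. \<alpha> i) = 3. c \<alpha> * (\<Prod>i\<in>UNIV. x $ i ^ \<alpha> i))"
    using assms unfolding homogeneous_form_def by blast
  ultimately have "polar F" by blast
  then show thesis using that unfolding polar_def by blast
qed

section \<open>The derivatives of a cubic along a line\<close>

lemma span_pair: "vec.span {a, b :: complex^'n} = {s *s a + t *s b | s t. True}"
proof -
  have "x \<in> vec.span {a, b} \<longleftrightarrow> (\<exists>s t. x = s *s a + t *s b)" for x
    unfolding vec.span_breakdown_eq vec.span_empty singleton_iff
    by (simp add: diff_diff_eq eq_iff_diff_eq_0[symmetric])
  then show ?thesis by blast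
qed

lemma span_triple: "vec.span {a, b, d :: complex^'n} = {s *s a + t *s b + r *s d | s t r. True}"
proof -
  have "x \<in> vec.span {a, b, d} \<longleftrightarrow> (\<exists>s t r. x = s *s a + t *s b + r *s d)" for x
    unfolding vec.span_breakdown_eq vec.span_empty singleton_iff
    by (simp add: diff_diff_eq eq_iff_diff_eq_0[symmetric])
  then show ?thesis by blast
qed

definition binary_quadratic :: "complex^3 \<Rightarrow> complex \<Rightarrow> complex \<Rightarrow> complex" where
  "binary_quadratic n s t = n$1 * s\<^sup>2 + n$2 * s * t + n$3 * t\<^sup>2"

text \<open>A line on a smooth cubic together with a splitting of the ambient space: \<open>a, b\<close> span the line,
  \<open>e\<close> embeds a complement, and \<open>crd\<close> is the projection to the complement along the line.
  Every chart of the Grassmannian provides such a splitting at each of its lines, so the same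
  analysis serves the coordinate-free notion of a triple line and the equations in the charts.\<close>

locale line_frame = symmetric_trilinear T
  for T :: "complex^5 \<Rightarrow> complex^5 \<Rightarrow> complex^5 \<Rightarrow> complex" +
  fixes a b :: "complex^5" and e :: "complex^3 \<Rightarrow> complex^5" and crd :: "complex^5 \<Rightarrow> complex^3"
  assumes e_add: "e (u + v) = e u + e v" and e_scale: "e (k *s u) = k *s e u"
    and crd_add: "crd (x + y) = crd x + crd y" and crd_scale: "crd (k *s x) = k *s crd x"
    and crd_a: "crd a = 0" and crd_b: "crd b = 0" and crd_e: "crd (e u) = u"
    and crd_ker: "crd x = 0 \<Longrightarrow> x \<in> vec.span {a, b}"
    and ab_independent: "s *s a + t *s b = 0 \<Longrightarrow> s = 0 \<and> t = 0"
    and on_line: "T a a a = 0" "T a a b = 0" "T a b b = 0" "T b b b = 0"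
    and nonsingular: "x \<noteq> 0 \<Longrightarrow> \<exists>y. T x x y \<noteq> 0"
begin

text \<open>The coefficients of the binary quadratic form \<open>T x x (e u)\<close> in \<open>x = s a + t b\<close>.\<close>

definition Q :: "complex^3 \<Rightarrow> complex^3" where
  "Q u = vector [T a a (e u), 2 * T a b (e u), T b b (e u)]"

lemma Q_add: "Q (u + v) = Q u + Q v" and Q_scale: "Q (k *s u) = k *s Q u"
  by (simp_all add: Q_def vec_eq_iff forall_3 e_add e_scale multilinear algebra_simps)

lemma Q_eq_0_iff: "Q u = 0 \<longleftrightarrow> T a a (e u) = 0 \<and> T a b (e u) = 0 \<and> T b b (e u) = 0"
  by (simp add: Q_def vec_eq_iff forall_3)

lemma crd_0: "crd 0 = 0"
  using crd_scale[of 0 0] by simp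

lemma frame_coordinates:
  obtains s t where "x = s *s a + t *s b + e (crd x)"
proof -
  have "x - e (crd x) = x + (-1) *s e (crd x)" by (simp add: vec_eq_iff)
  then have "crd (x - e (crd x)) = 0"
    by (simp only: crd_add crd_scale crd_e) (simp add: vec_eq_iff)
  then obtain s t where "x - e (crd x) = s *s a + t *s b"
    using crd_ker span_pair[of a b] by blast
  then show thesis by (intro that[of s t]) (simp add: algebra_simps)
qed

lemma crd_comb: "crd (s *s a + t *s b + r *s e u) = r *s u"
  by (simp add: crd_add crd_scale crd_a crd_b crd_e)

lemma T_line: "x \<in> vec.span {a, b} \<Longrightarrow> y \<in> vec.span {a, b} \<Longrightarrow> z \<in> vec.span {a, b} \<Longrightarrow> T x y z = 0"
  unfolding span_pair by (auto simp: multilinear on_line swaps)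

text \<open>At a common zero \<open>x\<close> of all these forms \<open>T x x\<close> would vanish on the complement; as it
  vanishes on the line anyway, \<open>x\<close> would be a singular point of the cubic.\<close>

lemma base_point_free:
  assumes "(s, t) \<noteq> (0, 0)"
  obtains u where "binary_quadratic (Q u) s t \<noteq> 0"
proof -
  let ?x = "s *s a + t *s b"
  have "?x \<noteq> 0" using ab_independent assms by auto
  then obtain y where y: "T ?x ?x y \<noteq> 0" using nonsingular by blast
  obtain s' t' where "y = s' *s a + t' *s b + e (crd y)" by (rule frame_coordinates)
  then have "T ?x ?x y = T ?x ?x (s' *s a + t' *s b) + T ?x ?x (e (crd y))"
    by (metis add3)
  also have "T ?x ?x (s' *s a + t' *s b) = 0"
    by (intro T_line) (auto simp: span_pair)
  also have "T ?x ?x (e (crd y)) = binary_quadratic (Q (crd y)) s t"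
    by (simp add: binary_quadratic_def Q_def multilinear swap12[of b a] power2_eq_square algebra_simps)
  finally show thesis using that y by simp
qed

text \<open>A linear endomorphism of a three-dimensional space with a nonzero kernel has rank at most two.\<close>

lemma restricted_polars_dependent:
  assumes "u \<noteq> 0" "Q u = 0"
  shows "det3 (Q x) (Q y) (Q z) = 0"
proof -
  note lin = det3_linear_image[of Q, OF Q_add Q_scale]
  obtain y' z' where d: "det3 u y' z' \<noteq> 0" using extend_to_det3_nonzero assms(1) by blast
  have "det3 (Q u) (Q y') (Q z') = 0" using assms(2) by (simp add: det3_expand)
  then have "det3 (Q (axis 1 1)) (Q (axis 2 1)) (Q (axis 3 1)) = 0"
    using lin[of u y' z'] d by simp
  then show ?thesis using lin[of x y z] by simp
qed

text \<open>The hypothesis on \<open>x\<close> and \<open>y\<close> says that both multiples \<open>s l\<close> and \<open>t l\<close> of the linear form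
  \<open>l = g s + h t\<close> occur.  The determinant of these two together with any third form is the
  value of that form at the zero \<open>(- h, g)\<close> of \<open>l\<close>.  It vanishes by dependency, which
  contradicts base point freeness unless \<open>l = 0\<close>.\<close>

lemma no_common_factor:
  assumes "u \<noteq> 0" "Q u = 0"
    and "Q x = vector [g, h, 0]" "Q y = vector [0, g, h]"
  shows "g = 0 \<and> h = 0"
proof (rule ccontr)
  assume "\<not> (g = 0 \<and> h = 0)"
  then obtain z where "binary_quadratic (Q z) (- h) g \<noteq> 0"
    using base_point_free[of "- h" g] by auto
  moreover have "det3 (Q z) (Q x) (Q y) = binary_quadratic (Q z) (- h) g"
    unfolding assms(3,4) det3_expand binary_quadratic_def by (simp add: power2_eq_square algebra_simps)
  ultimately show False using restricted_polars_dependent[OF assms(1,2)] by simp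
qed

text \<open>If \<open>Q y\<close> and \<open>Q z\<close> were proportional, all forms would be multiples of a single one, whose
  zero would be a base point.\<close>

lemma kernel_complement_independent:
  assumes u: "Q u = 0" and d: "det3 u y z \<noteq> 0" and 0: "p *s Q y + q *s Q z = 0"
  shows "p = 0 \<and> q = 0"
proof (rule ccontr)
  assume pq: "\<not> (p = 0 \<and> q = 0)"
  have eq: "p * Q y $ i + q * Q z $ i = 0" for i using 0 by (simp add: vec_eq_iff)
  obtain n r1 r2 where n: "Q y = r1 *s n" "Q z = r2 *s n"
  proof (cases "p = 0")
    case True
    then have "Q z = 0 *s Q y" using 0 pq by (simp add: vec_eq_iff)
    then show thesis using that[of 1 "Q y" 0] by simp
  next
    case False
    have "Q y = (- q / p) *s Q z"
      using False eq by (simp add: vec_eq_iff field_simps eq_neg_iff_add_eq_0)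
    then show thesis using that[of "- q / p" "Q z" 1] by simp
  qed
  obtain s t where st: "(s, t) \<noteq> (0, 0)" "n$1 * s\<^sup>2 + n$2 * s * t + n$3 * t\<^sup>2 = 0"
    by (rule binary_quadratic_root)
  obtain w where w: "binary_quadratic (Q w) s t \<noteq> 0" using base_point_free st(1) by blast
  obtain k1 k2 k3 where "w = k1 *s u + k2 *s y + k3 *s z" using det3_basis[OF d] by blast
  then have "Q w = k2 *s (r1 *s n) + k3 *s (r2 *s n)"
    by (simp add: Q_add Q_scale u n)
  then have "Q w = (k2 * r1 + k3 * r2) *s n"
    by (simp add: vec_eq_iff algebra_simps)
  then have "binary_quadratic (Q w) s t = (k2 * r1 + k3 * r2) * (n$1 * s\<^sup>2 + n$2 * s * t + n$3 * t\<^sup>2)"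
    by (simp add: binary_quadratic_def algebra_simps)
  then show False using w st(2) by simp
qed

lemma kernel_one_dimensional:
  assumes "u \<noteq> 0" "Q u = 0" "Q w = 0"
  obtains k where "w = k *s u"
proof -
  obtain y z where d: "det3 u y z \<noteq> 0" using extend_to_det3_nonzero assms(1) by blast
  obtain k1 k2 k3 where w: "w = k1 *s u + k2 *s y + k3 *s z" using det3_basis[OF d] by blast
  then have "k2 *s Q y + k3 *s Q z = 0"
    using assms(2,3) by (simp add: Q_add Q_scale)
  then have "k2 = 0 \<and> k3 = 0" using kernel_complement_independent[OF assms(2) d] by blast
  then have "w = k1 *s u" using w by simp
  then show thesis by (rule that)
qed

section \<open>Triple lines\<close>

text \<open>The plane through the line and \<open>e u\<close> is tangent along the line, and the residual line
  coincides with it.\<close>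

definition triple_direction :: "complex^3 \<Rightarrow> bool" where
  "triple_direction u \<longleftrightarrow> u \<noteq> 0 \<and> Q u = 0 \<and> T a (e u) (e u) = 0 \<and> T b (e u) (e u) = 0"

text \<open>If the cube vanished too, the plane \<open>P\<close> spanned by \<open>a, b, e u\<close> would lie in the cubic, so that
  \<open>T x x\<close> vanishes on \<open>P\<close> for \<open>x\<close> in \<open>P\<close>.  In two directions \<open>e y, e z\<close> transversal to \<open>P\<close> it
  is a pair of conics on \<open>P\<close>; a common point of them is a singular point of the cubic.\<close>

lemma triple_direction_cube_nonzero:
  assumes "triple_direction u"
  shows "T (e u) (e u) (e u) \<noteq> 0"
proof
  assume c: "T (e u) (e u) (e u) = 0"
  have u: "u \<noteq> 0" "T a a (e u) = 0" "T a b (e u) = 0" "T b b (e u) = 0"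
    "T a (e u) (e u) = 0" "T b (e u) (e u) = 0"
    using assms unfolding triple_direction_def Q_eq_0_iff by auto
  obtain y z where d: "det3 u y z \<noteq> 0" using extend_to_det3_nonzero u(1) by blast
  define P where "P x = x$1 *s a + x$2 *s b + x$3 *s e u" for x :: "complex^3"
  have P_add: "P (x + x') = P x + P x'" and P_scale: "P (k *s x) = k *s P x" for x x' k
    by (simp_all add: P_def vec_eq_iff algebra_simps)
  have conic: "conic (\<lambda>x x'. T (P x) (P x') w)" for w
  proof
    fix x x' y k
    show "T (P (x + x')) (P y) w = T (P x) (P y) w + T (P x') (P y) w"
      "T (P (k *s x)) (P y) w = k * T (P x) (P y) w"
      by (simp_all add: P_add P_scale multilinear)
    show "T (P x) (P y) w = T (P y) (P x) w" by (rule swap12)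
  qed
  obtain x where x: "x \<noteq> 0" "T (P x) (P x) (e y) = 0" "T (P x) (P x) (e z) = 0"
    using two_conics_meet[OF conic conic, of "e y" "e z"] by blast
  have plane: "T (P x) (P x) a = 0" "T (P x) (P x) b = 0" "T (P x) (P x) (e u) = 0"
    unfolding P_def by (simp_all add: multilinear on_line u c swaps)
  have "P x \<noteq> 0"
  proof
    assume 0: "P x = 0"
    then have "crd (P x) = 0" by (simp add: crd_0)
    then have "x$3 = 0" using u(1) by (simp add: P_def crd_comb)
    then have "x$1 *s a + x$2 *s b = 0" using 0 by (simp add: P_def)
    then have "x$1 = 0 \<and> x$2 = 0" by (rule ab_independent)
    then show False using x(1) \<open>x$3 = 0\<close> by (simp add: vec_eq_iff forall_3)
  qed
  then obtain w where w: "T (P x) (P x) w \<noteq> 0" using nonsingular by blast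
  obtain s t where st: "w = s *s a + t *s b + e (crd w)" by (rule frame_coordinates)
  obtain k1 k2 k3 where k: "crd w = k1 *s u + k2 *s y + k3 *s z" using det3_basis[OF d] by blast
  have "w = s *s a + t *s b + (k1 *s e u + k2 *s e y + k3 *s e z)"
    using st unfolding k by (simp add: e_add e_scale)
  then have "T (P x) (P x) w = 0" by (simp add: multilinear plane x)
  then show False using w by simp
qed

lemma independent_ab: "vec.independent {a, b}" "a \<noteq> b"
proof -
  have "b \<noteq> 0" using ab_independent[of 0 1] by auto
  moreover have "a \<notin> vec.span {b}"
  proof
    assume "a \<in> vec.span {b}"
    then obtain k where "a = k *s b" unfolding vec.span_singleton by blast
    then have "1 *s a + (- k) *s b = 0" by (simp add: vec_eq_iff)
    then show False using ab_independent by fastforce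
  qed
  ultimately show "vec.independent {a, b}"
    by (simp add: vec.independent_insert vec.independent_empty vec.span_empty)
  show "a \<noteq> b" using \<open>a \<notin> vec.span {b}\<close> vec.span_base[of b "{b}"] by blast
qed

lemma crd_span: "x \<in> vec.span {a, b} \<longleftrightarrow> crd x = 0"
  using crd_ker by (auto simp: span_pair crd_add crd_scale crd_a crd_b)

lemma dim_line: "vec.dim (vec.span {a, b}) = 2"
  using independent_ab vec.dim_span_eq_card_independent[of "{a, b}"] by simp

lemma dim_plane:
  assumes "w \<notin> vec.span {a, b}"
  shows "vec.dim (vec.span {a, b, w}) = 3"
proof -
  have "vec.independent (insert w {a, b})"
    using assms independent_ab(1) by (rule vec.independent_insertI)
  moreover have "card (insert w {a, b}) = 3"
    proof -
    have "w \<noteq> a" "w \<noteq> b" using assms vec.span_base[of _ "{a, b}"] by blast+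
    then show ?thesis using independent_ab(2) by simp
  qed
  ultimately have "vec.dim (vec.span (insert w {a, b})) = 3"
    using vec.dim_span_eq_card_independent by metis
  then show ?thesis by (simp add: insert_commute)
qed

text \<open>Any plane that meets the cubic doubly along the line is obtained from a kernel vector of \<open>Q\<close>.
  For the vector \<open>u\<close> take the component in the complement of a point \<open>w\<close> of the plane off the
  line, and compare the coefficients of \<open>r\<close> and \<open>r\<^sup>2\<close> in \<open>F (x + r u)\<close> with those of the
  divisor.\<close>

lemma plane_section_direction:
  assumes F: "\<And>x. F x = T x x x"
    and sec: "plane_section_2L_L' F P (vec.span {a, b}) L'"
  obtains u where "u \<noteq> 0" "Q u = 0" "P = vec.span {a, b, e u}"
    "L' = vec.span {a, b} \<Longrightarrow> triple_direction u"
proof -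
  let ?L = "vec.span {a, b}"
  obtain \<alpha> \<beta> where P: "vec.subspace P" "vec.dim P = 3"
    and \<alpha>: "homogeneous_form 1 \<alpha>" and \<beta>: "homogeneous_form 1 \<beta>"
    and L: "?L = {x \<in> P. \<alpha> x = 0}" and L': "L' = {x \<in> P. \<beta> x = 0}"
    and FP: "\<And>x. x \<in> P \<Longrightarrow> F x = (\<alpha> x)\<^sup>2 * \<beta> x"
    using sec unfolding plane_section_2L_L'_def projective_plane_def by blast
  note lin = homogeneous_form_1D[OF \<alpha>] homogeneous_form_1D[OF \<beta>]
  have "P \<noteq> ?L" using P(2) dim_line by auto
  then obtain w where w: "w \<in> P" "w \<notin> ?L" using L by blast
  define u where "u = crd w"
  obtain s t where st: "w = s *s a + t *s b + e u" unfolding u_def by (rule frame_coordinates)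
  have ab: "a \<in> P" "b \<in> P" using L vec.span_base[of _ "{a, b}"] by blast+
  have u0: "u \<noteq> 0" using w(2) by (simp add: crd_span u_def)
  have "e u = w - s *s a - t *s b" using st by (simp add: algebra_simps)
  then have eu: "e u \<in> P"
    using P(1) w(1) ab by (simp add: vec.subspace_diff vec.subspace_scale)
  have eu_L: "e u \<notin> ?L" using u0 by (simp add: crd_span crd_e)
  have "vec.span {a, b, e u} \<subseteq> P" using ab eu P(1) by (intro vec.span_minimal) auto
  then have P_eq: "P = vec.span {a, b, e u}"
    using vec.subspace_dim_equal[of "vec.span {a, b, e u}" P] dim_plane[OF eu_L] P by simp
  have x: "T x x (e u) = 0 \<and> 3 * T x (e u) (e u) = (\<alpha> (e u))\<^sup>2 * \<beta> x" if "x \<in> ?L" for x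
  proof -
    have xP: "x \<in> P" "\<alpha> x = 0" using that L by auto
    have F_eq: "3 * r * T x x (e u) + 3 * r\<^sup>2 * T x (e u) (e u) + r ^ 3 * T (e u) (e u) (e u)
        = r\<^sup>2 * (\<alpha> (e u))\<^sup>2 * (\<beta> x + r * \<beta> (e u))" for r
    proof -
      have "x + r *s e u \<in> P" using xP eu P(1) by (simp add: vec.subspace_add vec.subspace_scale)
      then have "F (x + r *s e u) = r\<^sup>2 * (\<alpha> (e u))\<^sup>2 * (\<beta> x + r * \<beta> (e u))"
        using FP[of "x + r *s e u"] by (simp add: lin xP(2) power_mult_distrib)
      moreover have "F (x + r *s e u)
          = 3 * r * T x x (e u) + 3 * r\<^sup>2 * T x (e u) (e u) + r ^ 3 * T (e u) (e u) (e u)"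
        unfolding F cube_of_sum using T_line[OF that that that] by simp
      ultimately show ?thesis by simp
    qed
    \<comment> \<open>Both sides are cubic in \<open>r\<close> without constant term, so three values of \<open>r\<close> determine them.\<close>
    define A B C where "A = 3 * T x x (e u)"
      and "B = 3 * T x (e u) (e u) - (\<alpha> (e u))\<^sup>2 * \<beta> x"
      and "C = T (e u) (e u) (e u) - (\<alpha> (e u))\<^sup>2 * \<beta> (e u)"
    have "r * A + r\<^sup>2 * B + r ^ 3 * C = 0" for r
      using F_eq[of r] unfolding A_def B_def C_def by (simp add: power2_eq_square power3_eq_cube algebra_simps)
    from this[of 1] this[of "-1"] this[of 2]
    have 1: "A + B + C = 0" and 2: "- A + B - C = 0" and 3: "2 * A + 4 * B + 8 * C = 0" by simp_all
    have "2 * B = 0" using 1 2 by algebra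
    moreover have "6 * A = 0" using 1 2 3 by algebra
    ultimately show ?thesis by (simp add: A_def B_def)
  qed
  have "T (a + b) (a + b) (e u) = T a a (e u) + 2 * T a b (e u) + T b b (e u)"
    by (simp add: multilinear swap12[of b a])
  moreover have "T a a (e u) = 0" "T b b (e u) = 0" "T (a + b) (a + b) (e u) = 0"
    using x by (simp_all add: vec.span_base vec.span_add)
  ultimately have Q: "Q u = 0" unfolding Q_eq_0_iff by simp
  have "triple_direction u" if "L' = ?L"
  proof -
    have "a \<in> ?L" "b \<in> ?L" by (simp_all add: vec.span_base)
    then have "\<beta> a = 0" "\<beta> b = 0" using L' that by auto
    then have "T a (e u) (e u) = 0" "T b (e u) (e u) = 0"
      using x[of a] x[of b] \<open>a \<in> ?L\<close> \<open>b \<in> ?L\<close> by auto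
    then show ?thesis using u0 Q by (simp add: triple_direction_def)
  qed
  then show thesis using that[OF u0 Q P_eq] by blast
qed

text \<open>The linear form \<open>\<alpha>\<close> is the coordinate along \<open>e u\<close> of the plane; the restriction of the cubic
  is a nonzero multiple of its cube.\<close>

lemma triple_direction_plane_section:
  assumes F: "\<And>x. F x = T x x x" and u: "triple_direction u"
  shows "plane_section_2L_L' F (vec.span {a, b, e u}) (vec.span {a, b}) (vec.span {a, b})"
proof -
  have u0: "u \<noteq> 0" and Tu: "T a a (e u) = 0" "T a b (e u) = 0" "T b b (e u) = 0"
    "T a (e u) (e u) = 0" "T b (e u) (e u) = 0"
    using u unfolding triple_direction_def Q_eq_0_iff by auto
  define k where "k = T (e u) (e u) (e u)"
  have k: "k \<noteq> 0" using triple_direction_cube_nonzero[OF u] k_def by simp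
  obtain i where i: "u $ i \<noteq> 0" using u0 by (auto simp: vec_eq_iff)
  define \<alpha> where "\<alpha> x = crd x $ i / u $ i" for x
  have \<alpha>: "homogeneous_form 1 \<alpha>" "homogeneous_form 1 (\<lambda>x. k * \<alpha> x)"
    by (rule homogeneous_form_1I; simp add: \<alpha>_def crd_add crd_scale add_divide_distrib algebra_simps)+
  have \<alpha>_eq: "\<alpha> (s *s a + t *s b + r *s e u) = r" for s t r
    using i by (simp add: \<alpha>_def crd_comb)
  have L: "vec.span {a, b} = {x \<in> vec.span {a, b, e u}. \<alpha> x = 0}"
  proof (intro set_eqI iffI CollectI conjI)
    fix x assume "x \<in> vec.span {a, b}"
    then obtain s t where x: "x = s *s a + t *s b + 0 *s e u" unfolding span_pair by auto
    show "x \<in> vec.span {a, b, e u}" unfolding span_triple x by blast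
    show "\<alpha> x = 0" unfolding x by (rule \<alpha>_eq)
  next
    fix x assume "x \<in> {x \<in> vec.span {a, b, e u}. \<alpha> x = 0}"
    then obtain s t r where x: "x = s *s a + t *s b + r *s e u" and "\<alpha> x = 0"
      unfolding span_triple by blast
    then have "r = 0" using \<alpha>_eq by metis
    then have "x = s *s a + t *s b" using x by simp
    then show "x \<in> vec.span {a, b}" unfolding span_pair by blast
  qed
  have "F x = (\<alpha> x)\<^sup>2 * (k * \<alpha> x)" if plane: "x \<in> vec.span {a, b, e u}" for x
  proof -
    obtain s t r where x: "x = s *s a + t *s b + r *s e u" using plane unfolding span_triple by blast
    have "F x = r ^ 3 * k"
      unfolding F x by (simp add: multilinear on_line Tu k_def swaps power3_eq_cube)
    then show ?thesis using \<alpha>_eq x by (simp add: power2_eq_square power3_eq_cube)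
  qed
  moreover have "projective_plane (vec.span {a, b, e u})"
    using u0 by (simp add: projective_plane_def dim_plane crd_span crd_e del: vec.dim_span)
  moreover have "projective_line (vec.span {a, b})"
    by (simp add: projective_line_def dim_line del: vec.dim_span)
  moreover have "vec.span {a, b} = {x \<in> vec.span {a, b, e u}. k * \<alpha> x = 0}"
    unfolding L using k by simp
  ultimately show ?thesis
    unfolding plane_section_2L_L'_def using \<alpha> L
    by (intro conjI exI[of _ \<alpha>] exI[of _ "\<lambda>x. k * \<alpha> x"]) simp_all
qed

lemma line_on_span:
  assumes F: "\<And>x. F x = T x x x"
  shows "line_on F (vec.span {a, b})"
  unfolding line_on_def projective_line_def using T_line dim_line by (simp add: F del: vec.dim_span)

lemma span_plane_scale:
  assumes "k \<noteq> 0"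
  shows "vec.span {a, b, e (k *s u)} = vec.span {a, b, e u}"
proof -
  have "r *s e (k *s u) = (r * k) *s e u" "r *s e u = (r / k) *s e (k *s u)" for r
    using assms by (simp_all add: e_scale vec_eq_iff)
  then show ?thesis
    unfolding span_triple set_eq_iff mem_Collect_eq by metis
qed

lemma triple_line_iff_triple_direction:
  assumes F: "\<And>x. F x = T x x x"
  shows "triple_line F (vec.span {a, b}) \<longleftrightarrow> (\<exists>u. triple_direction u)"
proof
  assume "triple_line F (vec.span {a, b})"
  then show "\<exists>u. triple_direction u"
    unfolding triple_line_def using plane_section_direction[OF F] by metis
next
  assume "\<exists>u. triple_direction u"
  then obtain u where u: "triple_direction u" ..
  let ?P = "vec.span {a, b, e u}"
  have sec: "plane_section_2L_L' F ?P (vec.span {a, b}) (vec.span {a, b})"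
    by (rule triple_direction_plane_section[OF F u])
  have "P' = ?P" if sec': "plane_section_2L_L' F P' (vec.span {a, b}) L'" for P' L'
  proof -
    obtain w where w: "w \<noteq> 0" "Q w = 0" "P' = vec.span {a, b, e w}"
      using plane_section_direction[OF F sec'] by blast
    obtain k where k: "w = k *s u"
      using kernel_one_dimensional w(2) u unfolding triple_direction_def by metis
    then have "k \<noteq> 0" using w(1) by auto
    then show ?thesis using w(3) k span_plane_scale by simp
  qed
  then show "triple_line F (vec.span {a, b})"
    unfolding triple_line_def second_type_def using sec line_on_span[OF F] by blast
qed

end

section \<open>The chart of the Grassmannian\<close>

lemma forall_5: "(\<forall>i::5. P i) \<longleftrightarrow> P 0 \<and> P 1 \<and> P 2 \<and> P 3 \<and> P 4"
proof -
  have "i = 0 \<or> i = 1 \<or> i = 2 \<or> i = 3 \<or> i = 4" for i :: 5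
  proof (induct i)
    case (of_int z)
    then have "z = 0 \<or> z = 1 \<or> z = 2 \<or> z = 3 \<or> z = 4" by (simp; arith)
    then show ?case by auto
  qed
  then show ?thesis by metis
qed

lemma forall_6: "(\<forall>i::6. P i) \<longleftrightarrow> P 0 \<and> P 1 \<and> P 2 \<and> P 3 \<and> P 4 \<and> P 5"
proof -
  have "i = 0 \<or> i = 1 \<or> i = 2 \<or> i = 3 \<or> i = 4 \<or> i = 5" for i :: 6
  proof (induct i)
    case (of_int z)
    then have "z = 0 \<or> z = 1 \<or> z = 2 \<or> z = 3 \<or> z = 4 \<or> z = 5" by (simp; arith)
    then show ?case by auto
  qed
  then show ?thesis by metis
qed

definition emb :: "complex^3 \<Rightarrow> complex^5" where
  "emb u = u$1 *s axis 2 1 + u$2 *s axis 3 1 + u$3 *s axis 4 1"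

text \<open>The projection to the coordinates 2, 3, 4 along the line with parameter \<open>p\<close>.\<close>

definition chart_coords :: "complex^6 \<Rightarrow> complex^5 \<Rightarrow> complex^3" where
  "chart_coords p y = vector [y$2 + y$0 * p$3 - y$1 * p$0, y$3 + y$0 * p$4 - y$1 * p$1,
     y$4 + y$0 * p$5 - y$1 * p$2]"

lemma v0_nth: "v0 p $ 0 = 1" "v0 p $ 1 = 0" "v0 p $ 2 = - p$3" "v0 p $ 3 = - p$4" "v0 p $ 4 = - p$5"
  by (simp_all add: v0_def axis_def)

lemma v1_nth: "v1 p $ 0 = 0" "v1 p $ 1 = 1" "v1 p $ 2 = p$0" "v1 p $ 3 = p$1" "v1 p $ 4 = p$2"
  by (simp_all add: v1_def axis_def)

lemma emb_nth: "emb u $ 0 = 0" "emb u $ 1 = 0" "emb u $ 2 = u$1" "emb u $ 3 = u$2" "emb u $ 4 = u$3"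
  by (simp_all add: emb_def axis_def)

lemmas chart_nth = v0_nth v1_nth emb_nth

lemma line_frame_chart:
  assumes "symmetric_trilinear T"
    and line: "\<And>x. x \<in> chart_line p \<Longrightarrow> T x x x = 0"
    and ns: "\<And>x. x \<noteq> 0 \<Longrightarrow> \<exists>y. T x x y \<noteq> 0"
  shows "line_frame T (v0 p) (v1 p) emb (chart_coords p)"
proof -
  interpret symmetric_trilinear T by fact
  let ?a = "v0 p" and ?b = "v1 p"
  have F0: "T (s *s ?a + t *s ?b) (s *s ?a + t *s ?b) (s *s ?a + t *s ?b) = 0" for s t
    using line unfolding chart_line_def span_pair by blast
  have e: "T ?a ?a ?a + 3 * r * T ?a ?a ?b + 3 * r\<^sup>2 * T ?a ?b ?b + r ^ 3 * T ?b ?b ?b = 0" for r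
    using F0[of 1 r] unfolding cube_of_sum by (simp only: vector_smult_lid cube_of_sum)
  have aaa: "T ?a ?a ?a = 0" using e[of 0] by simp
  have bbb: "T ?b ?b ?b = 0" using F0[of 0 1] by simp
  have 1: "3 * T ?a ?a ?b + 3 * T ?a ?b ?b = 0" and 2: "- 3 * T ?a ?a ?b + 3 * T ?a ?b ?b = 0"
    using e[of 1] e[of "-1"] by (simp_all add: aaa bbb)
  have "6 * T ?a ?b ?b = 0" "6 * T ?a ?a ?b = 0" using 1 2 by algebra+
  then have aab: "T ?a ?a ?b = 0" and abb: "T ?a ?b ?b = 0" by simp_all
  show ?thesis
  proof
    show "x \<in> vec.span {?a, ?b}" if c: "chart_coords p x = 0" for x
    proof -
      have "x = x$0 *s ?a + x$1 *s ?b"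
        using c by (simp add: vec_eq_iff forall_5 forall_3 chart_coords_def chart_nth algebra_simps)
      then show ?thesis unfolding span_pair by blast
    qed
    show "s = 0 \<and> t = 0" if "s *s ?a + t *s ?b = 0" for s t
      using that by (simp add: vec_eq_iff forall_5 chart_nth)
    show "\<exists>y. T x x y \<noteq> 0" if "x \<noteq> 0" for x using ns that .
  qed (simp_all add: emb_def chart_coords_def vec_eq_iff forall_5 forall_3 chart_nth algebra_simps
      axis_def aaa aab abb bbb)
qed

text \<open>Transport of a splitting along a linear automorphism, used for the permutations of the
  coordinates.\<close>

lemma line_frame_image:
  fixes g h :: "complex^5 \<Rightarrow> complex^5"
  assumes T: "symmetric_trilinear T"
    and fr: "line_frame (\<lambda>x y z. T (g x) (g y) (g z)) a b e c"
    and g: "\<And>x y. g (x + y) = g x + g y" "\<And>k x. g (k *s x) = k *s g x"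
    and h: "\<And>x y. h (x + y) = h x + h y" "\<And>k x. h (k *s x) = k *s h x"
    and inv: "\<And>x. g (h x) = x" "\<And>x. h (g x) = x"
  shows "line_frame T (g a) (g b) (\<lambda>u. g (e u)) (\<lambda>x. c (h x))"
proof -
  interpret T: symmetric_trilinear T by fact
  interpret fr: line_frame "\<lambda>x y z. T (g x) (g y) (g z)" a b e c by fact
  have g0: "g 0 = 0" and h0: "h 0 = 0" using g(2)[of 0 0] h(2)[of 0 0] by simp_all
  show ?thesis
  proof
    show "x \<in> vec.span {g a, g b}" if ker: "c (h x) = 0" for x
    proof -
      obtain s t where "h x = s *s a + t *s b"
        using fr.crd_ker[OF ker] unfolding span_pair by blast
      then have "g (h x) = s *s g a + t *s g b" by (simp add: g)
      then show ?thesis unfolding span_pair inv by blast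
    qed
    show "s = 0 \<and> t = 0" if "s *s g a + t *s g b = 0" for s t
    proof -
      have "g (s *s a + t *s b) = 0" using that by (simp add: g)
      then have "h (g (s *s a + t *s b)) = 0" by (simp add: h0)
      then show ?thesis unfolding inv by (rule fr.ab_independent)
    qed
    show "\<exists>y. T x x y \<noteq> 0" if "x \<noteq> 0" for x
    proof -
      have "h x \<noteq> 0" using that inv(1)[of x] g0 by auto
      then show ?thesis using fr.nonsingular[of "h x"] by (auto simp: inv)
    qed
  qed (simp_all add: g h inv fr.e_add fr.e_scale fr.crd_add fr.crd_scale fr.crd_a fr.crd_b
      fr.crd_e fr.on_line)
qed

text \<open>Some \<open>2 \<times> 2\<close> minor of a basis of the line is nonzero.  Move its two columns to the positions
  0 and 1, and normalise the basis so that this minor becomes the identity matrix.\<close>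

lemma exists_chart:
  assumes L: "projective_line L"
  obtains \<sigma> p where "bij \<sigma>" "L = permute_coords \<sigma> ` chart_line p"
proof -
  have sub: "vec.subspace L" and dim: "vec.dim L = 2" using L by (auto simp: projective_line_def)
  obtain B where B: "B \<subseteq> L" "vec.independent B" "L \<subseteq> vec.span B" "card B = 2"
    using vec.basis_exists[of L] dim by metis
  then obtain x y where xy: "B = {x, y}" "x \<noteq> y" by (auto simp: card_2_iff)
  have xL: "x \<in> L" "y \<in> L" using B(1) xy by auto
  have "\<exists>i j. x$i * y$j \<noteq> x$j * y$i"
  proof (rule ccontr)
    assume "\<nexists>i j. x$i * y$j \<noteq> x$j * y$i"
    then have minors: "x$i * y$j = x$j * y$i" for i j by blast
    have "y \<noteq> 0" using B(2) xy vec.dependent_zero by blast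
    then obtain j where j: "y $ j \<noteq> 0" by (auto simp: vec_eq_iff)
    have "x = (x$j / y$j) *s y" using j minors[of _ j] by (simp add: vec_eq_iff field_simps)
    then have "x \<in> vec.span {y}" unfolding vec.span_singleton by blast
    then show False using B(2) xy by (simp add: vec.independent_insert)
  qed
  then obtain i j where ij: "x$i * y$j - x$j * y$i \<noteq> 0" by auto
  then have "i \<noteq> j" by auto
  define \<sigma> where "\<sigma> = Transposition.transpose 1 (Transposition.transpose 0 i j) \<circ> Transposition.transpose 0 (i::5)"
  have bij: "bij \<sigma>" unfolding \<sigma>_def by (intro bij_comp bij_swap bij_transpose)
  have "Transposition.transpose 0 i j \<noteq> 0" using \<open>i \<noteq> j\<close> by (auto simp: Transposition.transpose_def)
  then have \<sigma>: "\<sigma> i = 0" "\<sigma> j = 1" by (auto simp: \<sigma>_def Transposition.transpose_def)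
  define \<Delta> where "\<Delta> = x$i * y$j - x$j * y$i"
  define x' where "x' = (y$j / \<Delta>) *s x - (x$j / \<Delta>) *s y"
  define y' where "y' = (x$i / \<Delta>) *s y - (y$i / \<Delta>) *s x"
  have xL': "x' \<in> L" "y' \<in> L"
    unfolding x'_def y'_def using xL sub by (simp_all add: vec.subspace_diff vec.subspace_scale)
  have "\<Delta> \<noteq> 0" using ij by (simp add: \<Delta>_def)
  then have nth: "x' $ i = 1" "x' $ j = 0" "y' $ i = 0" "y' $ j = 1"
    by (simp_all add: x'_def y'_def field_simps) (simp_all add: \<Delta>_def algebra_simps)
  define \<tau> where "\<tau> = inv \<sigma>"
  have \<tau>\<sigma>: "\<tau> (\<sigma> k) = k" for k using bij by (simp add: \<tau>_def bij_is_inj)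
  have \<tau>: "\<tau> 0 = i" "\<tau> 1 = j" using \<tau>\<sigma> \<sigma> by metis+
  define p :: "complex^6" where "p = (\<chi> k. if k = 0 then y' $ \<tau> 2 else if k = 1 then y' $ \<tau> 3
    else if k = 2 then y' $ \<tau> 4 else if k = 3 then - x' $ \<tau> 2 else if k = 4 then - x' $ \<tau> 3
    else - x' $ \<tau> 4)"
  have p: "p$0 = y' $ \<tau> 2" "p$1 = y' $ \<tau> 3" "p$2 = y' $ \<tau> 4" "p$3 = - x' $ \<tau> 2"
    "p$4 = - x' $ \<tau> 3" "p$5 = - x' $ \<tau> 4"
    by (simp_all add: p_def)
  have vx: "v0 p $ k = x' $ \<tau> k" and vy: "v1 p $ k = y' $ \<tau> k" for k
  proof -
    have "\<forall>k. v0 p $ k = x' $ \<tau> k" "\<forall>k. v1 p $ k = y' $ \<tau> k"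
      unfolding forall_5 by (simp_all add: chart_nth p \<tau> nth)
    then show "v0 p $ k = x' $ \<tau> k" "v1 p $ k = y' $ \<tau> k" by auto
  qed
  have P: "permute_coords \<sigma> (s *s v0 p + t *s v1 p) = s *s x' + t *s y'" for s t
    by (simp add: permute_coords_def vec_eq_iff vx vy \<tau>\<sigma>)
  have img: "permute_coords \<sigma> ` chart_line p = vec.span {x', y'}"
    unfolding chart_line_def span_pair using P by (auto simp: image_iff) metis+
  have "vec.independent {x', y'}" "x' \<noteq> y'"
  proof -
    show "x' \<noteq> y'" using nth by auto
    have "x' \<notin> vec.span {y'}"
      unfolding vec.span_singleton using nth by (auto simp: vec_eq_iff) 
    moreover have "y' \<noteq> 0" using nth by auto
    ultimately show "vec.independent {x', y'}"
      by (simp add: vec.independent_insert vec.independent_empty vec.span_empty)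
  qed
  then have "vec.dim (vec.span {x', y'}) = 2"
    using vec.dim_span_eq_card_independent[of "{x', y'}"] by simp
  moreover have "vec.span {x', y'} \<subseteq> L" using xL' sub by (intro vec.span_minimal) auto
  ultimately have "vec.span {x', y'} = L"
    using vec.subspace_dim_equal[of "vec.span {x', y'}" L] sub dim vec.subspace_span by (simp del: vec.dim_span)
  then show thesis using that[OF bij] img by blast
qed

section \<open>The equations of the curve and their gradients\<close>

text \<open>The coefficients of a binary form are determined by its values, so the description in \<open>phi\<close>
  has a unique solution.\<close>

lemma phi_eqI:
  assumes "\<And>t0 t1. G (t0 *s v0 p + t1 *s v1 p) = (\<Sum>k\<le>i+j. t0 ^ k * t1 ^ (i + j - k) * a k)"
  shows "phi G i j p = a i"
  unfolding phi_def
proof (rule the_equality)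
  show "\<exists>a'. a' i = a i \<and> (\<forall>t0 t1. G (t0 *s v0 p + t1 *s v1 p)
      = (\<Sum>k\<le>i+j. t0 ^ k * t1 ^ (i + j - k) * a' k))"
    using assms by (intro exI[of _ a]) simp
  fix c assume "\<exists>a'. a' i = c \<and> (\<forall>t0 t1. G (t0 *s v0 p + t1 *s v1 p)
      = (\<Sum>k\<le>i+j. t0 ^ k * t1 ^ (i + j - k) * a' k))"
  then obtain a' where a': "a' i = c"
    and eq: "\<And>t0 t1. G (t0 *s v0 p + t1 *s v1 p) = (\<Sum>k\<le>i+j. t0 ^ k * t1 ^ (i + j - k) * a' k)"
    by blast
  have "(\<Sum>k\<le>i+j. a' k * t ^ k) = (\<Sum>k\<le>i+j. a k * t ^ k)" for t
    using eq[of t 1] assms[of t 1] by (simp add: mult.commute)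
  then have "\<forall>k\<le>i+j. a' k = a k" using polyfun_eq_coeffs by blast
  then show "c = a i" using a' by simp
qed

lemma (in symmetric_trilinear) partial_cube:
  assumes "\<And>x. F x = T x x x"
  shows "partial F k x = 3 * T x x (axis k 1)"
proof -
  have "((\<lambda>t. F (x + t *s axis k 1)) has_field_derivative 3 * T x x (axis k 1)) (at 0)"
    unfolding assms cube_of_sum by (auto intro!: derivative_eq_intros)
  then show ?thesis unfolding partial_def by (rule DERIV_imp_deriv)
qed

lemma (in symmetric_trilinear) has_derivative_along:
  "((\<lambda>t. T (x + t *s x') (y + t *s y') (z + t *s z')) has_field_derivative
     T x' y z + T x y' z + T x y z') (at 0)"
  by (auto intro!: derivative_eq_intros simp: multilinear)

text \<open>At a line on the cubic this is the map \<open>Q\<close>; as a function of \<open>p\<close> it is needed for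
  all lines of the chart, in order to differentiate it.\<close>

definition chart_quadric :: "(complex^5 \<Rightarrow> complex^5 \<Rightarrow> complex^5 \<Rightarrow> complex) \<Rightarrow> complex^6 \<Rightarrow> complex^3 \<Rightarrow> complex^3" where
  "chart_quadric T p u = vector [T (v0 p) (v0 p) (emb u), 2 * T (v0 p) (v1 p) (emb u), T (v1 p) (v1 p) (emb u)]"

context
  fixes T :: "complex^5 \<Rightarrow> complex^5 \<Rightarrow> complex^5 \<Rightarrow> complex" and F :: "complex^5 \<Rightarrow> complex"
  assumes T: "symmetric_trilinear T" and F: "\<And>x. F x = T x x x"
begin

interpretation symmetric_trilinear T by (rule T)

lemma phi_cubic:
  "phi F 3 0 = (\<lambda>p. T (v0 p) (v0 p) (v0 p))"
  "phi F 2 1 = (\<lambda>p. 3 * T (v0 p) (v0 p) (v1 p))"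
  "phi F 1 2 = (\<lambda>p. 3 * T (v0 p) (v1 p) (v1 p))"
  "phi F 0 3 = (\<lambda>p. T (v1 p) (v1 p) (v1 p))"
proof -
  define a where "a p k = [T (v1 p) (v1 p) (v1 p), 3 * T (v0 p) (v1 p) (v1 p),
    3 * T (v0 p) (v0 p) (v1 p), T (v0 p) (v0 p) (v0 p)] ! k" for p k
  have "F (t0 *s v0 p + t1 *s v1 p) = (\<Sum>k\<le>3. t0 ^ k * t1 ^ (3 - k) * a p k)" for t0 t1 p
    unfolding F cube_of_comb by (simp add: a_def numeral_3_eq_3 algebra_simps) (simp add: numeral_eq_Suc)
  then have "i + j = 3 \<Longrightarrow> phi F i j p = a p i" for i j p
    by (intro phi_eqI) simp
  then show "phi F 3 0 = (\<lambda>p. T (v0 p) (v0 p) (v0 p))"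
    "phi F 2 1 = (\<lambda>p. 3 * T (v0 p) (v0 p) (v1 p))"
    "phi F 1 2 = (\<lambda>p. 3 * T (v0 p) (v1 p) (v1 p))"
    "phi F 0 3 = (\<lambda>p. T (v1 p) (v1 p) (v1 p))"
    by (simp_all add: a_def fun_eq_iff)
qed

lemma phi_partial:
  "phi (partial F k) 2 0 p = 3 * T (v0 p) (v0 p) (axis k 1)"
  "phi (partial F k) 1 1 p = 6 * T (v0 p) (v1 p) (axis k 1)"
  "phi (partial F k) 0 2 p = 3 * T (v1 p) (v1 p) (axis k 1)"
proof -
  define a where "a n = [3 * T (v1 p) (v1 p) (axis k 1), 6 * T (v0 p) (v1 p) (axis k 1),
    3 * T (v0 p) (v0 p) (axis k 1)] ! n" for n
  have "partial F k (t0 *s v0 p + t1 *s v1 p) = (\<Sum>n\<le>2. t0 ^ n * t1 ^ (2 - n) * a n)" for t0 t1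
    unfolding partial_cube[of F, OF F] square_of_sum
    by (simp add: a_def numeral_2_eq_2 algebra_simps) 
  then have "i + j = 2 \<Longrightarrow> phi (partial F k) i j p = a i" for i j
    by (intro phi_eqI) simp
  then show "phi (partial F k) 2 0 p = 3 * T (v0 p) (v0 p) (axis k 1)"
    "phi (partial F k) 1 1 p = 6 * T (v0 p) (v1 p) (axis k 1)"
    "phi (partial F k) 0 2 p = 3 * T (v1 p) (v1 p) (axis k 1)"
    by (simp_all add: a_def)
qed

lemma chart_quadric_linear:
  "chart_quadric T p (u + v) = chart_quadric T p u + chart_quadric T p v"
  "chart_quadric T p (k *s u) = k *s chart_quadric T p u"
  by (simp_all add: chart_quadric_def emb_def vec_eq_iff forall_3 multilinear algebra_simps)

text \<open>The coefficients of a partial derivative on the line are \<open>3, 6, 3\<close> times values of \<open>T\<close>; with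
  the factor 2 in \<open>chart_quadric\<close> each row of the matrix contributes a factor 3.\<close>

lemma m_eq_det3:
  "m F p = 27 * det3 (chart_quadric T p (axis 1 1)) (chart_quadric T p (axis 2 1)) (chart_quadric T p (axis 3 1))"
proof -
  have "emb (axis 1 1) = axis 2 1" "emb (axis 2 1) = axis 3 1" "emb (axis 3 1) = axis 4 1"
    by (simp_all add: emb_def axis_def vec_eq_iff)
  then show ?thesis
    by (simp add: m_def det_3 det3_expand chart_quadric_def phi_partial algebra_simps
        del: One_nat_def)
qed

text \<open>This allows \<open>m\<close> to be computed in a basis of the complement that is adapted to the kernel of
  \<open>Q\<close>.\<close>

lemma m_times_det3:
  "m F p * det3 u y z
    = 27 * det3 (chart_quadric T p u) (chart_quadric T p y) (chart_quadric T p z)"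
  unfolding m_eq_det3 det3_linear_image[of "chart_quadric T p", OF chart_quadric_linear, of u y z]
  by simp

end

text \<open>A differential presented by directional derivatives: this is what enters the equations of the
  Zariski tangent space, see \<open>has_gradientD\<close>.\<close>

definition has_gradient :: "(complex^'n \<Rightarrow> complex) \<Rightarrow> complex^'n \<Rightarrow> (complex^'n \<Rightarrow> complex) \<Rightarrow> bool" where
  "has_gradient g p G \<longleftrightarrow> (\<forall>w. ((\<lambda>t. g (p + t *s w)) has_field_derivative G w) (at 0)) \<and>
     (\<forall>v w. G (v + w) = G v + G w) \<and> (\<forall>k w. G (k *s w) = k * G w)"

lemma has_gradientD:
  assumes "has_gradient g p G"
  shows "(\<Sum>k\<in>UNIV. partial g k p * w $ k) = G w"
proof -
  have "partial g k p = G (axis k 1)" for k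
    unfolding partial_def using assms unfolding has_gradient_def by (intro DERIV_imp_deriv) blast
  then show ?thesis using assms linear_expansion[of G] unfolding has_gradient_def by simp
qed

lemma has_gradient_cmult: "has_gradient g p G \<Longrightarrow> has_gradient (\<lambda>p. c * g p) p (\<lambda>w. c * G w)"
  unfolding has_gradient_def by (auto intro: DERIV_cmult simp: algebra_simps)

definition affine_map :: "(complex^'m \<Rightarrow> complex^'n) \<Rightarrow> (complex^'m \<Rightarrow> complex^'n) \<Rightarrow> bool" where
  "affine_map x dx \<longleftrightarrow> (\<forall>p t w. x (p + t *s w) = x p + t *s dx w)"

lemma affine_map_linear:
  assumes "affine_map x dx"
  shows "dx (v + w) = dx v + dx w" "dx (k *s w) = k *s dx w"
proof -
  have x: "x (p + t *s w) = x p + t *s dx w" for p t w using assms affine_map_def by blast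
  have "x (0 + 1 *s (v + w)) = x ((0 + 1 *s v) + 1 *s w)" by simp
  then show "dx (v + w) = dx v + dx w" unfolding x by simp
  have "x (0 + 1 *s (k *s w)) = x (0 + k *s w)" by simp
  then show "dx (k *s w) = k *s dx w" unfolding x by simp
qed

lemma (in symmetric_trilinear) has_gradient_T:
  assumes "affine_map x dx" "affine_map y dy" "affine_map z dz"
  shows "has_gradient (\<lambda>p. T (x p) (y p) (z p)) p
    (\<lambda>w. T (dx w) (y p) (z p) + T (x p) (dy w) (z p) + T (x p) (y p) (dz w))"
proof -
  have e: "x (p + t *s w) = x p + t *s dx w" "y (p + t *s w) = y p + t *s dy w"
    "z (p + t *s w) = z p + t *s dz w" for t w
    using assms affine_map_def by blast+
  note lin = affine_map_linear[OF assms(1)] affine_map_linear[OF assms(2)] affine_map_linear[OF assms(3)]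
  show ?thesis
    unfolding has_gradient_def e
  proof (intro conjI allI)
    show "((\<lambda>t. T (x p + t *s dx w) (y p + t *s dy w) (z p + t *s dz w)) has_field_derivative
      T (dx w) (y p) (z p) + T (x p) (dy w) (z p) + T (x p) (y p) (dz w)) (at 0)" for w
      by (rule has_derivative_along)
  qed (simp_all add: lin multilinear algebra_simps)
qed

text \<open>Since \<open>X\<close> vanishes at \<open>p\<close>, the terms of the product rule that differentiate \<open>Y\<close> or \<open>Z\<close>
  drop out.\<close>

lemma has_gradient_det3:
  assumes X: "\<And>i. has_gradient (\<lambda>p. X p $ i) p (\<lambda>w. X' w $ i)"
    and Y: "\<And>i. has_gradient (\<lambda>p. Y p $ i) p (\<lambda>w. Y' w $ i)"
    and Z: "\<And>i. has_gradient (\<lambda>p. Z p $ i) p (\<lambda>w. Z' w $ i)"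
    and X0: "X p = 0"
  shows "has_gradient (\<lambda>p. det3 (X p) (Y p) (Z p)) p (\<lambda>w. det3 (X' w) (Y p) (Z p))"
proof -
  have d: "((\<lambda>t. X (p + t *s w) $ i) has_field_derivative X' w $ i) (at 0)"
    "((\<lambda>t. Y (p + t *s w) $ i) has_field_derivative Y' w $ i) (at 0)"
    "((\<lambda>t. Z (p + t *s w) $ i) has_field_derivative Z' w $ i) (at 0)" for w i
    using X Y Z unfolding has_gradient_def by blast+
  have "((\<lambda>t. det3 (X (p + t *s w)) (Y (p + t *s w)) (Z (p + t *s w)))
      has_field_derivative det3 (X' w) (Y p) (Z p)) (at 0)" for w
    unfolding det3_expand
    by (rule derivative_eq_intros d refl)+ (simp add: X0 algebra_simps)
  moreover have "X' (v + w) = X' v + X' w" "X' (k *s w) = k *s X' w" for v w k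
    using X unfolding has_gradient_def by (simp_all add: vec_eq_iff)
  ultimately show ?thesis
    unfolding has_gradient_def by (simp add: det3_multilinear)
qed

text \<open>The parameter \<open>w\<close> of a tangent vector of the Grassmannian corresponds to the pair
  \<open>(dv0 w, dv1 w)\<close> of velocities of the two spanning vectors, and \<open>chart_vector\<close> is the inverse
  correspondence.\<close>

definition dv0 :: "complex^6 \<Rightarrow> complex^3" where "dv0 w = vector [- w$3, - w$4, - w$5]"
definition dv1 :: "complex^6 \<Rightarrow> complex^3" where "dv1 w = vector [w$0, w$1, w$2]"

lemma affine_v0: "affine_map v0 (\<lambda>w. emb (dv0 w))"
  and affine_v1: "affine_map v1 (\<lambda>w. emb (dv1 w))"
  by (simp_all add: affine_map_def vec_eq_iff forall_5 chart_nth dv0_def dv1_def)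

lemma affine_const: "affine_map (\<lambda>p. x) (\<lambda>w. 0)"
  by (simp add: affine_map_def)

definition chart_vector :: "complex^3 \<Rightarrow> complex^3 \<Rightarrow> complex^6" where
  "chart_vector x y = (\<chi> k. if k = 0 then y$1 else if k = 1 then y$2 else if k = 2 then y$3
     else if k = 3 then - x$1 else if k = 4 then - x$2 else - x$3)"

lemma chart_vector_nth: "chart_vector x y $ 0 = y$1" "chart_vector x y $ 1 = y$2" "chart_vector x y $ 2 = y$3"
  "chart_vector x y $ 3 = - x$1" "chart_vector x y $ 4 = - x$2" "chart_vector x y $ 5 = - x$3"
  by (simp_all add: chart_vector_def)

lemma dv_chart_vector: "dv0 (chart_vector x y) = x" "dv1 (chart_vector x y) = y" "chart_vector (dv0 w) (dv1 w) = w"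
  by (simp_all add: vec_eq_iff forall_3 forall_6 dv0_def dv1_def chart_vector_nth)

lemma subspace_zariski_tangent_space: "vec.subspace (zariski_tangent_space E p)"
proof -
  have 1: "(\<Sum>k\<in>UNIV. partial g k p * (v + w) $ k)
      = (\<Sum>k\<in>UNIV. partial g k p * v $ k) + (\<Sum>k\<in>UNIV. partial g k p * w $ k)" for g v w
    by (simp add: algebra_simps sum.distrib)
  have 2: "(\<Sum>k\<in>UNIV. partial g k p * (c *s w) $ k) = c * (\<Sum>k\<in>UNIV. partial g k p * w $ k)" for g c w
    by (simp add: algebra_simps sum_distrib_left)
  show ?thesis
    unfolding vec.subspace_def zariski_tangent_space_def mem_Collect_eq 1 2 by simp
qed

section \<open>The Zariski tangent space of the curve\<close>

context
  fixes T :: "complex^5 \<Rightarrow> complex^5 \<Rightarrow> complex^5 \<Rightarrow> complex" and F :: "complex^5 \<Rightarrow> complex"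
    and p :: "complex^6"
  assumes T: "symmetric_trilinear T" and F: "\<And>x. F x = T x x x"
    and frame: "line_frame T (v0 p) (v1 p) emb (chart_coords p)"
begin

interpretation line_frame T "v0 p" "v1 p" emb "chart_coords p" by (rule frame)

lemma chart_quadric_eq_Q: "chart_quadric T p u = Q u"
  by (simp add: chart_quadric_def Q_def)

lemma has_gradient_phi:
  "has_gradient (phi F 3 0) p (\<lambda>w. 3 * T (v0 p) (v0 p) (emb (dv0 w)))"
  "has_gradient (phi F 2 1) p (\<lambda>w. 3 * (2 * T (v0 p) (v1 p) (emb (dv0 w)) + T (v0 p) (v0 p) (emb (dv1 w))))"
  "has_gradient (phi F 1 2) p (\<lambda>w. 3 * (T (v1 p) (v1 p) (emb (dv0 w)) + 2 * T (v0 p) (v1 p) (emb (dv1 w))))"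
  "has_gradient (phi F 0 3) p (\<lambda>w. 3 * T (v1 p) (v1 p) (emb (dv1 w)))"
proof -
  have s: "T y x x = T x x y" "T x y x = T x x y" for x y
    using swap12 swap23 by metis+
  note aff = affine_v0 affine_v1
  have "3 * T (v0 p) (v0 p) (emb x) = T (emb x) (v0 p) (v0 p) + T (v0 p) (emb x) (v0 p) + T (v0 p) (v0 p) (emb x)"
    "3 * T (v1 p) (v1 p) (emb x) = T (emb x) (v1 p) (v1 p) + T (v1 p) (emb x) (v1 p) + T (v1 p) (v1 p) (emb x)"
    "3 * (2 * T (v0 p) (v1 p) (emb x) + T (v0 p) (v0 p) (emb y))
      = 3 * (T (emb x) (v0 p) (v1 p) + T (v0 p) (emb x) (v1 p) + T (v0 p) (v0 p) (emb y))"
    "3 * (T (v1 p) (v1 p) (emb x) + 2 * T (v0 p) (v1 p) (emb y))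
      = 3 * (T (emb x) (v1 p) (v1 p) + T (v0 p) (emb y) (v1 p) + T (v0 p) (v1 p) (emb y))" for x y
    by (simp_all add: s swap23[of _ "emb _"] swap12[of "emb _"])
  note eqs = this
  show "has_gradient (phi F 3 0) p (\<lambda>w. 3 * T (v0 p) (v0 p) (emb (dv0 w)))"
    "has_gradient (phi F 2 1) p (\<lambda>w. 3 * (2 * T (v0 p) (v1 p) (emb (dv0 w)) + T (v0 p) (v0 p) (emb (dv1 w))))"
    "has_gradient (phi F 1 2) p (\<lambda>w. 3 * (T (v1 p) (v1 p) (emb (dv0 w)) + 2 * T (v0 p) (v1 p) (emb (dv1 w))))"
    "has_gradient (phi F 0 3) p (\<lambda>w. 3 * T (v1 p) (v1 p) (emb (dv1 w)))"
    unfolding phi_cubic[OF T F] eqs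
    by (intro has_gradient_cmult has_gradient_T aff)+
qed

text \<open>The differential of \<open>chart_quadric\<close>.  The coefficients are those of the form
  \<open>2 T x (e u) (s dv0 w + t dv1 w)\<close> in \<open>x = s v0 + t v1\<close>, up to the embedding of the
  complement.\<close>

definition dQ :: "complex^3 \<Rightarrow> complex^6 \<Rightarrow> complex^3" where
  "dQ u w = vector [2 * T (v0 p) (emb u) (emb (dv0 w)),
     2 * (T (v1 p) (emb u) (emb (dv0 w)) + T (v0 p) (emb u) (emb (dv1 w))),
     2 * T (v1 p) (emb u) (emb (dv1 w))]"

lemma has_gradient_chart_quadric:
  "has_gradient (\<lambda>p. chart_quadric T p u $ i) p (\<lambda>w. dQ u w $ i)"
proof -
  have e: "dQ u w $ 1 = T (emb (dv0 w)) (v0 p) (emb u) + T (v0 p) (emb (dv0 w)) (emb u) + T (v0 p) (v0 p) 0"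
    "dQ u w $ 2 = 2 * (T (emb (dv0 w)) (v1 p) (emb u) + T (v0 p) (emb (dv1 w)) (emb u) + T (v0 p) (v1 p) 0)"
    "dQ u w $ 3 = T (emb (dv1 w)) (v1 p) (emb u) + T (v1 p) (emb (dv1 w)) (emb u) + T (v1 p) (v1 p) 0" for w
    by (simp_all add: dQ_def zero3 swap12[of "emb _"] swap23[of _ "emb (dv0 w)"] swap23[of _ "emb (dv1 w)"])
  have "\<forall>i. has_gradient (\<lambda>p. chart_quadric T p u $ i) p (\<lambda>w. dQ u w $ i)"
    unfolding forall_3 chart_quadric_def vector_3 e
    by (intro conjI has_gradient_cmult has_gradient_T affine_v0 affine_v1 affine_const)
  then show ?thesis by blast
qed

lemma has_gradient_m:
  assumes "Q u = 0" "det3 u y z \<noteq> 0"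
  shows "has_gradient (m F) p (\<lambda>w. 27 / det3 u y z * det3 (dQ u w) (Q y) (Q z))"
proof -
  have "m F = (\<lambda>p. 27 / det3 u y z * det3 (chart_quadric T p u) (chart_quadric T p y) (chart_quadric T p z))"
    using m_times_det3[OF T F, of _ u y z] assms(2) by (simp add: fun_eq_iff field_simps)
  moreover have "has_gradient (\<lambda>p. 27 / det3 u y z
      * det3 (chart_quadric T p u) (chart_quadric T p y) (chart_quadric T p z)) p
      (\<lambda>w. 27 / det3 u y z * det3 (dQ u w) (chart_quadric T p y) (chart_quadric T p z))"
    by (rule has_gradient_cmult, rule has_gradient_det3, (rule has_gradient_chart_quadric)+)
      (simp add: chart_quadric_eq_Q assms(1))
  ultimately show ?thesis by (simp only: chart_quadric_eq_Q)
qed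

text \<open>The first four equations say that the form \<open>s q + t q'\<close> is zero, where \<open>q, q'\<close> have the
  coefficients \<open>Q (dv0 w)\<close> and \<open>Q (dv1 w)\<close>.  So there is a linear form \<open>l\<close> with \<open>q = t l\<close>
  and \<open>q' = - s l\<close>; by \<open>no_common_factor\<close> it is zero, and both velocities lie in the kernel of
  \<open>Q\<close>.  This is the tangent plane of the Fano surface, cut by the differential of \<open>m\<close>.\<close>

lemma tangent_space_M_equations:
  assumes u: "u \<noteq> 0" "Q u = 0" and d: "det3 u y z \<noteq> 0"
  shows "zariski_tangent_space (M_equations F) p
    = {w. \<exists>\<alpha> \<beta>. w = chart_vector (\<alpha> *s u) (\<beta> *s u) \<and> det3 (dQ u w) (Q y) (Q z) = 0}"
proof -
  have cancel3: "6 * x + 3 * y = 0 \<longleftrightarrow> 2 * x + y = 0" "3 * x + 6 * y = 0 \<longleftrightarrow> x + 2 * y = 0"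
    for x y :: complex
  proof -
    have "6 * x + 3 * y = 3 * (2 * x + y)" "3 * x + 6 * y = 3 * (x + 2 * y)" by simp_all
    then show "6 * x + 3 * y = 0 \<longleftrightarrow> 2 * x + y = 0" "3 * x + 6 * y = 0 \<longleftrightarrow> x + 2 * y = 0"
      by (simp_all only: mult_eq_0_iff) simp_all
  qed
  have "w \<in> zariski_tangent_space (M_equations F) p \<longleftrightarrow>
      T (v0 p) (v0 p) (emb (dv0 w)) = 0 \<and>
      2 * T (v0 p) (v1 p) (emb (dv0 w)) + T (v0 p) (v0 p) (emb (dv1 w)) = 0 \<and>
      T (v1 p) (v1 p) (emb (dv0 w)) + 2 * T (v0 p) (v1 p) (emb (dv1 w)) = 0 \<and>
      T (v1 p) (v1 p) (emb (dv1 w)) = 0 \<and> det3 (dQ u w) (Q y) (Q z) = 0" for w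
    using d by (simp add: zariski_tangent_space_def M_equations_def
        has_gradient_phi[THEN has_gradientD] has_gradient_m[OF u(2) d, THEN has_gradientD] cancel3
        del: One_nat_def)
  moreover have "T (v0 p) (v0 p) (emb (dv0 w)) = 0 \<and>
      2 * T (v0 p) (v1 p) (emb (dv0 w)) + T (v0 p) (v0 p) (emb (dv1 w)) = 0 \<and>
      T (v1 p) (v1 p) (emb (dv0 w)) + 2 * T (v0 p) (v1 p) (emb (dv1 w)) = 0 \<and>
      T (v1 p) (v1 p) (emb (dv1 w)) = 0 \<longleftrightarrow> (\<exists>\<alpha> \<beta>. w = chart_vector (\<alpha> *s u) (\<beta> *s u))" (is "?eqs \<longleftrightarrow> ?tan") for w
  proof
    assume eqs: ?eqs
    define g h where "g = 2 * T (v0 p) (v1 p) (emb (dv0 w))" and "h = T (v1 p) (v1 p) (emb (dv0 w))"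
    have "Q (dv0 w) = vector [0, g, h]" using eqs by (simp add: Q_def g_def h_def)
    moreover have "Q ((-1) *s dv1 w) = vector [g, h, 0]"
    proof -
      have "T (v0 p) (v0 p) (emb (dv1 w)) = - g" "2 * T (v0 p) (v1 p) (emb (dv1 w)) = - h"
        using eqs unfolding g_def h_def by (metis add.inverse_unique)+
      then show ?thesis
        unfolding Q_scale using eqs by (simp add: Q_def vec_eq_iff forall_3)
    qed
    ultimately have "g = 0 \<and> h = 0" using no_common_factor[OF u] by blast
    then have "Q (dv0 w) = 0" "Q (dv1 w) = 0"
      using eqs unfolding Q_eq_0_iff g_def h_def by simp_all
    then obtain \<alpha> \<beta> where "dv0 w = \<alpha> *s u" "dv1 w = \<beta> *s u"
      using kernel_one_dimensional[OF u] by metis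
    then show ?tan using dv_chart_vector(3)[of w] by metis
  next
    assume ?tan
    then show ?eqs using u(2) unfolding Q_eq_0_iff
      by (auto simp: dv_chart_vector e_scale multilinear)
  qed
  ultimately show ?thesis by blast
qed

text \<open>On the tangent plane of the Fano surface the differential of \<open>Q u\<close> is the product of
  \<open>2 (\<alpha> s + \<beta> t)\<close> with the linear form \<open>T x (emb u) (emb u)\<close>.\<close>

lemma dQ_chart_vector:
  "dQ u (chart_vector (\<alpha> *s u) (\<beta> *s u))
    = (2 * \<alpha>) *s vector [T (v0 p) (emb u) (emb u), T (v1 p) (emb u) (emb u), 0]
    + (2 * \<beta>) *s vector [0, T (v0 p) (emb u) (emb u), T (v1 p) (emb u) (emb u)]"
  by (simp add: dQ_def dv_chart_vector e_scale multilinear vec_eq_iff forall_3 algebra_simps)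

lemma m_eq_0_iff: "m F p = 0 \<longleftrightarrow> (\<exists>u. u \<noteq> 0 \<and> Q u = 0)"
proof
  assume "m F p = 0"
  then have "det3 (Q (axis 1 1)) (Q (axis 2 1)) (Q (axis 3 1)) = 0"
    using m_eq_det3[OF T F, of p] by (simp add: chart_quadric_eq_Q)
  then obtain k :: "complex^3" where k: "k \<noteq> 0"
    "k$1 *s Q (axis 1 1) + k$2 *s Q (axis 2 1) + k$3 *s Q (axis 3 1) = 0"
    by (rule det3_dependent)
  have "Q k = 0" using k(2) by (subst complex3_axes[of k]) (simp add: Q_add Q_scale)
  then show "\<exists>u. u \<noteq> 0 \<and> Q u = 0" using k(1) by blast
next
  assume "\<exists>u. u \<noteq> 0 \<and> Q u = 0"
  then obtain u where u: "u \<noteq> 0" "Q u = 0" by blast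
  obtain y z where d: "det3 u y z \<noteq> 0" using extend_to_det3_nonzero u(1) by blast
  show "m F p = 0"
    using m_times_det3[OF T F, of p u y z] d u(2) by (simp add: chart_quadric_eq_Q det3_expand)
qed

lemma chart_vector_comb: "chart_vector (\<alpha> *s u) (\<beta> *s u) = \<alpha> *s chart_vector u 0 + \<beta> *s chart_vector 0 u"
  by (simp add: vec_eq_iff forall_6 chart_vector_nth)

lemma dim_chart_vectors:
  assumes "u \<noteq> 0"
  shows "vec.dim (vec.span {chart_vector u 0, chart_vector 0 u}) = 2"
proof -
  obtain i where i: "u $ i \<noteq> 0" using assms by (auto simp: vec_eq_iff)
  have "chart_vector u 0 \<noteq> k *s chart_vector 0 u" for k
  proof
    assume "chart_vector u 0 = k *s chart_vector 0 u"
    then have "\<forall>i. u $ i = 0" unfolding vec_eq_iff forall_6 forall_3 by (simp add: chart_vector_nth)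
    then show False using i by blast
  qed
  then have "chart_vector u 0 \<notin> vec.span {chart_vector 0 u}" unfolding vec.span_singleton by blast
  moreover have "chart_vector 0 u \<noteq> 0"
  proof
    assume "chart_vector 0 u = 0"
    then have "\<forall>i. u $ i = 0" unfolding vec_eq_iff forall_6 forall_3 by (simp add: chart_vector_nth)
    then show False using i by blast
  qed
  ultimately have "vec.independent {chart_vector u 0, chart_vector 0 u}" "chart_vector u 0 \<noteq> chart_vector 0 u"
    using vec.span_base[of "chart_vector 0 u" "{chart_vector 0 u}"]
    by (auto simp add: vec.independent_insert vec.independent_empty vec.span_empty)
  then show ?thesis using vec.dim_span_eq_card_independent[of "{chart_vector u 0, chart_vector 0 u}"] by simp
qed

text \<open>At a point of the curve the tangent space lies in the tangent plane of the Fano surface, so it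
  has dimension greater than one if and only if it is this plane, that is, if the differential
  of \<open>m\<close> vanishes there.  The form \<open>Q u\<close> is zero, so \<open>Q y\<close> and \<open>Q z\<close> span the range of \<open>Q\<close>,
  and the determinants express that both coordinate multiples of the linear form
  \<open>T x (emb u) (emb u)\<close> belong to the range; \<open>no_common_factor\<close> then makes it zero.\<close>

lemma singular_iff_triple_direction:
  "(\<forall>g\<in>M_equations F. g p = 0) \<and> vec.dim (zariski_tangent_space (M_equations F) p) > 1
    \<longleftrightarrow> (\<exists>u. triple_direction u)"
proof
  assume sing: "(\<forall>g\<in>M_equations F. g p = 0) \<and> vec.dim (zariski_tangent_space (M_equations F) p) > 1"
  let ?Z = "zariski_tangent_space (M_equations F) p"
  obtain u where u: "u \<noteq> 0" "Q u = 0" using sing m_eq_0_iff by (auto simp: M_equations_def)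
  obtain y z where d: "det3 u y z \<noteq> 0" using extend_to_det3_nonzero u(1) by blast
  have "?Z \<subseteq> vec.span {chart_vector u 0, chart_vector 0 u}"
    unfolding tangent_space_M_equations[OF u d] chart_vector_comb span_pair by blast
  then have Z: "?Z = vec.span {chart_vector u 0, chart_vector 0 u}"
    using sing dim_chart_vectors[OF u(1)]
    by (intro vec.subspace_dim_equal) (auto simp: subspace_zariski_tangent_space simp del: vec.dim_span)
  have det: "det3 (dQ u (chart_vector (\<alpha> *s u) (\<beta> *s u))) (Q y) (Q z) = 0" for \<alpha> \<beta>
  proof -
    have "chart_vector (\<alpha> *s u) (\<beta> *s u) \<in> ?Z" unfolding Z chart_vector_comb span_pair by blast
    then show ?thesis unfolding tangent_space_M_equations[OF u d] by blast
  qed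
  let ?g = "T (v0 p) (emb u) (emb u)" and ?h = "T (v1 p) (emb u) (emb u)"
  have in_range: "\<exists>x. Q x = n" if "det3 n (Q y) (Q z) = 0" for n
  proof -
    obtain k :: "complex^3" where k: "k \<noteq> 0" "k$1 *s n + k$2 *s Q y + k$3 *s Q z = 0"
      using \<open>det3 n (Q y) (Q z) = 0\<close> by (rule det3_dependent)
    have "k$1 \<noteq> 0"
    proof
      assume "k$1 = 0"
      then have "k$2 = 0 \<and> k$3 = 0"
        using k(2) kernel_complement_independent[OF u(2) d, of "k$2" "k$3"] by simp
      then show False using k(1) \<open>k$1 = 0\<close> by (simp add: vec_eq_iff forall_3)
    qed
    then have "n = Q ((- k$2 / k$1) *s y + (- k$3 / k$1) *s z)"
      using k(2) unfolding Q_add Q_scale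
      by (simp add: vec_eq_iff field_simps eq_neg_iff_add_eq_0)
    then show ?thesis by metis
  qed
  have "det3 (2 *s vector [?g, ?h, 0]) (Q y) (Q z) = 0" "det3 (2 *s vector [0, ?g, ?h]) (Q y) (Q z) = 0"
    using det[of 1 0] det[of 0 1] unfolding dQ_chart_vector by simp_all
  then obtain x x' where "Q x = vector [?g, ?h, 0]" "Q x' = vector [0, ?g, ?h]"
    using in_range by (metis det3_scale1 mult_eq_0_iff zero_neq_numeral)
  then have "?g = 0 \<and> ?h = 0" using no_common_factor[OF u] by blast
  then show "\<exists>u. triple_direction u" using u unfolding triple_direction_def by blast
next
  assume "\<exists>u. triple_direction u"
  then obtain u where u: "u \<noteq> 0" "Q u = 0"
    and cube: "T (v0 p) (emb u) (emb u) = 0" "T (v1 p) (emb u) (emb u) = 0"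
    unfolding triple_direction_def by blast
  obtain y z where d: "det3 u y z \<noteq> 0" using extend_to_det3_nonzero u(1) by blast
  have "dQ u (chart_vector (\<alpha> *s u) (\<beta> *s u)) = 0" for \<alpha> \<beta>
    unfolding dQ_chart_vector cube by (simp add: vec_eq_iff forall_3)
  then have "chart_vector (\<alpha> *s u) (\<beta> *s u) \<in> zariski_tangent_space (M_equations F) p" for \<alpha> \<beta>
    unfolding tangent_space_M_equations[OF u d] by (simp add: det3_expand) blast
  then have "vec.span {chart_vector u 0, chart_vector 0 u} \<subseteq> zariski_tangent_space (M_equations F) p"
    unfolding span_pair chart_vector_comb by blast
  then have "2 \<le> vec.dim (zariski_tangent_space (M_equations F) p)"
    using vec.dim_subset dim_chart_vectors[OF u(1)] by metis
  moreover have "\<forall>g\<in>M_equations F. g p = 0"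
    using m_eq_0_iff u by (auto simp: M_equations_def phi_cubic[OF T F] on_line simp del: One_nat_def)
  ultimately show "(\<forall>g\<in>M_equations F. g p = 0) \<and> vec.dim (zariski_tangent_space (M_equations F) p) > 1"
    by simp
qed

end

section \<open>Triple lines are the singular points\<close>

lemma permute_coords_linear:
  "permute_coords \<sigma> (x + y) = permute_coords \<sigma> x + permute_coords \<sigma> y"
  "permute_coords \<sigma> (k *s x) = k *s permute_coords \<sigma> x"
  by (simp_all add: permute_coords_def vec_eq_iff)

lemma permute_coords_inv:
  assumes "bij \<sigma>"
  shows "permute_coords \<sigma> (permute_coords (inv \<sigma>) x) = x"
    "permute_coords (inv \<sigma>) (permute_coords \<sigma> x) = x"
  using assms by (simp_all add: permute_coords_def vec_eq_iff bij_is_inj bij_is_surj surj_f_inv_f)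

lemma smooth_nonsingular:
  assumes "symmetric_trilinear T" "\<And>x. F x = T x x x" "smooth_hypersurface F" "x \<noteq> 0"
  shows "\<exists>y. T x x y \<noteq> 0"
proof (rule ccontr)
  assume "\<nexists>y. T x x y \<noteq> 0"
  then have 0: "T x x y = 0" for y by blast
  then have "F x = 0" by (simp add: assms(2))
  then obtain i where "partial F i x \<noteq> 0"
    using assms(3,4) unfolding smooth_hypersurface_def by blast
  then show False using symmetric_trilinear.partial_cube[of T F i x, OF assms(1,2)] 0 by simp
qed

theorem theorem1p1:
  fixes F :: "complex^5 \<Rightarrow> complex" and L :: "(complex^5) set"
  assumes "homogeneous_form 3 F"
    and "smooth_hypersurface F"
    and "line_on F L"
  shows "triple_line F L \<longleftrightarrow> M_singular_point F L"
proof -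
  obtain T :: "complex^5 \<Rightarrow> complex^5 \<Rightarrow> complex^5 \<Rightarrow> complex"
    where T: "symmetric_trilinear T" and F: "\<And>x. F x = T x x x"
    by (rule cubic_form_polarization[OF assms(1)]) (rule that)
  interpret T: symmetric_trilinear T by (rule T)
  have line: "projective_line L" "\<And>x. x \<in> L \<Longrightarrow> F x = 0"
    using assms(3) unfolding line_on_def by blast+
  \<comment> \<open>In a chart both conditions express the existence of a triple direction, for \<open>T\<close> and for its
    pullback along the permutation.\<close>
  have chart: "triple_line F L \<longleftrightarrow> M_point_in_chart F L \<sigma> p
      \<and> vec.dim (zariski_tangent_space (M_equations (F \<circ> permute_coords \<sigma>)) p) > 1"
    if \<sigma>: "bij \<sigma>" and L: "L = permute_coords \<sigma> ` chart_line p" for \<sigma> p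
  proof -
    let ?g = "permute_coords \<sigma>" and ?h = "permute_coords (inv \<sigma>)"
    define T' where "T' = (\<lambda>x y z. T (?g x) (?g y) (?g z))"
    have T': "symmetric_trilinear T'"
      by unfold_locales (simp_all add: T'_def permute_coords_linear T.multilinear T.swaps)
    have F': "(F \<circ> ?g) x = T' x x x" for x by (simp add: F T'_def)
    have ns: "\<exists>y. T' x x y \<noteq> 0" if "x \<noteq> 0" for x
    proof -
      have "?h 0 = 0" using permute_coords_linear(2)[of "inv \<sigma>" 0 0] by simp
      then have "?g x \<noteq> 0" using \<open>x \<noteq> 0\<close> permute_coords_inv(2)[OF \<sigma>, of x] by auto
      then obtain y where "T (?g x) (?g x) y \<noteq> 0"
        using smooth_nonsingular[OF T F assms(2)] by blast
      then have "T' x x (?h y) \<noteq> 0" by (simp add: T'_def permute_coords_inv(1)[OF \<sigma>])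
      then show ?thesis ..
    qed
    have on_line: "T' x x x = 0" if "x \<in> chart_line p" for x
    proof -
      have "?g x \<in> L" unfolding L using \<open>x \<in> chart_line p\<close> by (rule imageI)
      then show ?thesis using line(2) by (simp add: T'_def F)
    qed
    have frame': "line_frame T' (v0 p) (v1 p) emb (chart_coords p)"
      by (rule line_frame_chart[OF T' on_line ns])
    have frame: "line_frame T (?g (v0 p)) (?g (v1 p)) (\<lambda>u. ?g (emb u)) (\<lambda>x. chart_coords p (?h x))"
      by (rule line_frame_image[OF T frame'[unfolded T'_def] permute_coords_linear
            permute_coords_linear permute_coords_inv[OF \<sigma>]])
    have span: "L = vec.span {?g (v0 p), ?g (v1 p)}"
    proof -
      have "L = {?g (s *s v0 p + t *s v1 p) | s t. True}"
        unfolding L chart_line_def span_pair by blast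
      then show ?thesis unfolding span_pair by (simp only: permute_coords_linear)
    qed
    have "triple_line F L
        \<longleftrightarrow> (\<exists>u. line_frame.triple_direction T (?g (v0 p)) (?g (v1 p)) (\<lambda>u. ?g (emb u)) u)"
      unfolding span by (rule line_frame.triple_line_iff_triple_direction[OF frame F])
    also have "\<dots> \<longleftrightarrow> (\<exists>u. line_frame.triple_direction T' (v0 p) (v1 p) emb u)"
      unfolding line_frame.triple_direction_def[OF frame] line_frame.triple_direction_def[OF frame']
        line_frame.Q_eq_0_iff[OF frame] line_frame.Q_eq_0_iff[OF frame']
      unfolding T'_def by (rule refl)
    also have "\<dots> \<longleftrightarrow> (\<forall>g\<in>M_equations (F \<circ> ?g). g p = 0)
        \<and> vec.dim (zariski_tangent_space (M_equations (F \<circ> ?g)) p) > 1"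
      by (rule singular_iff_triple_direction[OF T' F' frame', symmetric])
    finally show ?thesis unfolding M_point_in_chart_def using \<sigma> L by simp
  qed
  show ?thesis
  proof
    assume "triple_line F L"
    moreover obtain \<sigma> p where "bij \<sigma>" "L = permute_coords \<sigma> ` chart_line p"
      using line(1) by (rule exists_chart)
    ultimately show "M_singular_point F L" unfolding M_singular_point_def using chart by blast
  next
    assume "M_singular_point F L"
    then show "triple_line F L"
      unfolding M_singular_point_def using chart unfolding M_point_in_chart_def by metis
  qed
qed

end
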